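(* Let $(f,g)$ belong to the convex-strongly-convex class $\mathcal{F}_{csc}$ (see context), with $x^*\in\arg\min\Phi$, $\|x^*\|=B$, where in addition $g$ is quadratic of the form $g(x,y)=\frac12y^THy+x^TJy+b^Ty+h(x)$ with constant matrices $H,J$ satisfying $H\preceq\widetilde L_yI$, $J\preceq\widetilde L_{xy}I$ (so that $\nabla_x\nabla_yg$ and $\nabla_y^2g$ are constant). Apply AccBiO to $(\widetilde f,g)$, $\widetilde f(x,y)=f(x,y)+\frac{\epsilon}{2R}\|x\|^2$, with $\mu_x:=\epsilon/R$, heavy-ball parameters $\lambda=\frac{4}{(\sqrt{\widetilde L_y}+\sqrt{\mu_y})^2}$, $\theta=\max\{(1-\sqrt{\lambda\mu_y})^2,(1-\sqrt{\lambda\widetilde L_y})^2\}$, suitable smoothness parameter $L_{\widetilde\Phi}=\Theta(\mu_y^{-2})$ of $\widetilde\Phi(x)=\widetilde f(x,y^*(x))$, and suitable $N,M=\widetilde\Theta(\sqrt{\widetilde L_y/\mu_y})$. Then: (Suboptimality gap) with $R=B^2$, to achieve $\Phi(z_K)-\Phi(x^* )\le\epsilon$, one has $\mathcal{C}_{\mathrm{sub}}(\mathcal{A},\epsilon)\le\widetilde{\mathcal{O}}\Big(B\sqrt{\frac{\widetilde L_y}{\epsilon\mu_y^3}}\Big)$; (Gradient norm) with $R=B$, to achieve $\|\nabla\Phi(z_K)\|\le\epsilon$, one has $\mathcal{C}_{\mathrm{norm}}(\mathcal{A},\epsilon)\le\widetilde{\mathcal{O}}\Big(\sqrt{\frac{B\widetilde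 L_y}{\epsilon\mu_y^3}}\Big)$.
   Context: Bilevel problem: minimize $\Phi(x)=f(x,y^*(x))$, $y^*(x)=\arg\min_{y\in\mathbb{R}^q}g(x,y)$, $x\in\mathbb{R}^p$. Class $\mathcal{F}_{csc}$: (a) there are constants $L_x,L_{xy},L_y,\widetilde L_{xy},\widetilde L_y\ge0$ such that $\nabla_x f$ is $L_x$-Lipschitz in $x$ and $L_{xy}$-Lipschitz in $y$, $\nabla_y f$ is $L_{xy}$-Lipschitz in $x$ and $L_y$-Lipschitz in $y$, $\nabla_y g$ is $\widetilde L_{xy}$-Lipschitz in $x$ and $\widetilde L_y$-Lipschitz in $y$; (b) $\nabla_x\nabla_y g$ and $\nabla_y^2 g$ are Lipschitz in $(x,y)$ (with constants $0$ for quadratic $g$); (c) $\|x^*\|=B$ for some constant $B>0$, where $x^*\in\arg\min\Phi$; (d) $\Phi$ is convex and $g(x,\cdot)$ is $\mu_y$-strongly convex for every $x$. The condition $J\preceq\widetilde L_{xy}I$ is understood as a bound on the operator norm of $J$. AccBiO applied to a pair $(f,g)$ with smoothness parameter $L_\Phi$, $\kappa_x=L_\Phi/\mu_x$, $\kappa_y=\widetilde L_y/\mu_y$ (here it is applied to $(\widetilde f,g)$ with $L_{\widetilde\Phi}$): $z_0=x_0=0$. For $k=0,1,\dots$: set $y_k^0=s_k^0=0$ and for $t=1,\dots,N$: $y_k^t=s_k^{t-1}-\frac{1}{\widetilde L_y}\nabla_y g(x_k,s_k^{t-1})$, $s_k^t=\frac{2\sqrt{\kappa_y}}{\sqrt{\kappa_y}+1}y_k^t-\frac{\sqrt{\kappa_y}-1}{\sqrt{\kappa_y}+1}y_k^{t-1}$.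 Let $Q(v)=\frac12v^T\nabla_y^2g(x_k,y_k^N)v-v^T\nabla_yf(x_k,y_k^N)$ and let $v_k^M$ be the output of $M$ steps of the heavy-ball method $v_k^{t+1}=v_k^t-\lambda\nabla Q(v_k^t)+\theta(v_k^t-v_k^{t-1})$ with $v_k^0=v_k^1=0$. Set $G_k=\nabla_xf(x_k,y_k^N)-\nabla_x\nabla_yg(x_k,y_k^N)v_k^M$, $z_{k+1}=x_k-\frac{1}{L_\Phi}G_k$, $x_{k+1}=\big(1+\frac{\sqrt{\kappa_x}-1}{\sqrt{\kappa_x}+1}\big)z_{k+1}-\frac{\sqrt{\kappa_x}-1}{\sqrt{\kappa_x}+1}z_k$. Complexity: $\tau(n_J+n_H)+n_G$, where $n_J,n_H,n_G$ are the total numbers of Jacobian-vector products, Hessian-vector products and gradient evaluations and $\tau>0$ is a universal constant; it is denoted $\mathcal{C}_{\mathrm{sub}}$ for a suboptimality-gap goal and $\mathcal{C}_{\mathrm{norm}}$ for a gradient-norm goal. Order notation: $\mathcal{O},\Theta$ hide constants depending on $L_x,L_{xy},L_y,\widetilde L_{xy}$; $\widetilde{\mathcal{O}},\widetilde\Theta$ additionally hide factors logarithmic in $1/\epsilon,1/\mu_y$ and the remaining problem quantities. *)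

theory Defs
  imports "HOL-Analysis.Analysis"
begin

section \<open>Derivatives\<close>

definition grad :: "('a::real_inner \<Rightarrow> real) \<Rightarrow> 'a \<Rightarrow> 'a" where
  "grad F x = (THE D. GDERIV F x :> D)"

definition grad_x :: "('a::real_inner \<Rightarrow> 'b \<Rightarrow> real) \<Rightarrow> 'a \<Rightarrow> 'b \<Rightarrow> 'a" where
  "grad_x f x y = grad (\<lambda>u. f u y) x"

definition grad_y :: "('a \<Rightarrow> 'b::real_inner \<Rightarrow> real) \<Rightarrow> 'a \<Rightarrow> 'b \<Rightarrow> 'b" where
  "grad_y f x y = grad (\<lambda>w. f x w) y"

definition hess_yy :: "('a \<Rightarrow> real^'q \<Rightarrow> real) \<Rightarrow> 'a \<Rightarrow> real^'q \<Rightarrow> real^'q^'q" where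
  "hess_yy g x y = jacobian (\<lambda>w. grad_y g x w) (at y)"

text \<open>The mixed derivative is the \<open>p \<times> q\<close> matrix with entries
  \<open>\<partial>\<^sup>2 g / \<partial>x\<^sub>i \<partial>y\<^sub>j\<close>; the Jacobian of the \<open>y\<close>-gradient with respect to
  \<open>x\<close> is its transpose.\<close>

definition hess_xy :: "(real^'p \<Rightarrow> real^'q \<Rightarrow> real) \<Rightarrow> real^'p \<Rightarrow> real^'q \<Rightarrow> real^'q^'p" where
  "hess_xy g x y = transpose (jacobian (\<lambda>u. grad_y g u y) (at x))"

definition smooth_fun :: "real \<Rightarrow> ('a::real_inner \<Rightarrow> real) \<Rightarrow> bool" where
  "smooth_fun L F \<longleftrightarrow> (\<forall>x. F differentiable (at x)) \<and> L-lipschitz_on UNIV (grad F)"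

definition strongly_convex :: "real \<Rightarrow> ('a::real_inner \<Rightarrow> real) \<Rightarrow> bool" where
  "strongly_convex \<mu> F \<longleftrightarrow> \<mu> > 0 \<and> convex_on UNIV (\<lambda>y. F y - \<mu> / 2 * (norm y)\<^sup>2)"

text \<open>The Loewner order, for symmetric matrices.\<close>

definition loewner_le :: "real^'n^'n \<Rightarrow> real^'n^'n \<Rightarrow> bool" (infix \<open>\<preceq>\<close> 50) where
  "A \<preceq> B \<longleftrightarrow> (\<forall>v. v \<bullet> (A *v v) \<le> v \<bullet> (B *v v))"


section \<open>The bilevel problem and the convex-strongly-convex class\<close>

definition y_star :: "('a \<Rightarrow> 'b \<Rightarrow> real) \<Rightarrow> 'a \<Rightarrow> 'b" where
  "y_star g x = arg_min (g x) (\<lambda>_. True)"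

definition Phi :: "('a \<Rightarrow> 'b \<Rightarrow> real) \<Rightarrow> ('a \<Rightarrow> 'b \<Rightarrow> real) \<Rightarrow> 'a \<Rightarrow> real" where
  "Phi f g x = f x (y_star g x)"

text \<open>\<open>Lt_xy\<close> and \<open>Lt_y\<close> are the constants of the lower-level function \<open>g\<close>. The Lipschitz
  constants of the second derivatives of \<open>g\<close> are not named, so the choice of matrix norm there
  (the library norm is the Frobenius norm) is immaterial.\<close>

definition F_csc ::
  "real \<Rightarrow> real \<Rightarrow> real \<Rightarrow> real \<Rightarrow> real \<Rightarrow> real \<Rightarrow> real
    \<Rightarrow> ((real^'p \<Rightarrow> real^'q \<Rightarrow> real) \<times> (real^'p \<Rightarrow> real^'q \<Rightarrow> real)) set" where
  "F_csc L_x L_xy L_y Lt_xy Lt_y \<mu>_y B = {(f, g).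
     (\<forall>z. (\<lambda>(x, y). f x y) differentiable (at z)) \<and>
     (\<forall>x y. g x differentiable (at y)) \<and>
     (\<forall>z. (\<lambda>(x, y). grad_y g x y) differentiable (at z)) \<and>
     (\<forall>y. L_x-lipschitz_on UNIV (\<lambda>x. grad_x f x y)) \<and>
     (\<forall>x. L_xy-lipschitz_on UNIV (\<lambda>y. grad_x f x y)) \<and>
     (\<forall>y. L_xy-lipschitz_on UNIV (\<lambda>x. grad_y f x y)) \<and>
     (\<forall>x. L_y-lipschitz_on UNIV (\<lambda>y. grad_y f x y)) \<and>
     (\<forall>y. Lt_xy-lipschitz_on UNIV (\<lambda>x. grad_y g x y)) \<and>
     (\<forall>x. Lt_y-lipschitz_on UNIV (\<lambda>y. grad_y g x y)) \<and>
     (\<exists>\<rho>. \<rho>-lipschitz_on UNIV (\<lambda>(x, y). hess_xy g x y)) \<and>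
     (\<exists>\<rho>. \<rho>-lipschitz_on UNIV (\<lambda>(x, y). hess_yy g x y)) \<and>
     B > 0 \<and> (\<exists>xs. is_arg_min (Phi f g) (\<lambda>_. True) xs \<and> norm xs = B) \<and>
     convex_on UNIV (Phi f g) \<and>
     (\<forall>x. strongly_convex \<mu>_y (g x))}"

definition regularized ::
  "real \<Rightarrow> real \<Rightarrow> ('a::real_normed_vector \<Rightarrow> 'b \<Rightarrow> real) \<Rightarrow> 'a \<Rightarrow> 'b \<Rightarrow> real" where
  "regularized \<epsilon> R f x y = f x y + \<epsilon> / (2 * R) * (norm x)\<^sup>2"


section \<open>AccBiO\<close>

text \<open>The pair \<open>(y\<^sup>t, s\<^sup>t)\<close>.\<close>

primrec accbio_inner ::
  "('a \<Rightarrow> 'b::real_inner \<Rightarrow> real) \<Rightarrow> real \<Rightarrow> real \<Rightarrow> 'a \<Rightarrow> nat \<Rightarrow> 'b \<times> 'b" where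
  "accbio_inner g Lt_y \<mu>_y x 0 = (0, 0)"
| "accbio_inner g Lt_y \<mu>_y x (Suc t) =
    (let (y, s) = accbio_inner g Lt_y \<mu>_y x t;
         \<kappa> = Lt_y / \<mu>_y;
         y' = s - (1 / Lt_y) *\<^sub>R grad_y g x s
     in (y', (2 * sqrt \<kappa> / (sqrt \<kappa> + 1)) *\<^sub>R y' - ((sqrt \<kappa> - 1) / (sqrt \<kappa> + 1)) *\<^sub>R y))"

fun heavy_ball :: "('b::real_inner \<Rightarrow> real) \<Rightarrow> real \<Rightarrow> real \<Rightarrow> nat \<Rightarrow> 'b" where
  "heavy_ball Q lam \<theta> 0 = 0"
| "heavy_ball Q lam \<theta> (Suc 0) = 0"
| "heavy_ball Q lam \<theta> (Suc (Suc t)) =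
    heavy_ball Q lam \<theta> (Suc t) - lam *\<^sub>R grad Q (heavy_ball Q lam \<theta> (Suc t))
      + \<theta> *\<^sub>R (heavy_ball Q lam \<theta> (Suc t) - heavy_ball Q lam \<theta> t)"

definition hypergrad_estimate ::
  "(real^'p \<Rightarrow> real^'q \<Rightarrow> real) \<Rightarrow> (real^'p \<Rightarrow> real^'q \<Rightarrow> real) \<Rightarrow> real \<Rightarrow> real \<Rightarrow> real \<Rightarrow> real
    \<Rightarrow> nat \<Rightarrow> nat \<Rightarrow> real^'p \<Rightarrow> real^'p" where
  "hypergrad_estimate f g Lt_y \<mu>_y lam \<theta> N M x =
    (let y = fst (accbio_inner g Lt_y \<mu>_y x N);
         Q = (\<lambda>v. 1 / 2 * (v \<bullet> (hess_yy g x y *v v)) - v \<bullet> grad_y f x y)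
     in grad_x f x y - hess_xy g x y *v heavy_ball Q lam \<theta> M)"

text \<open>The pair \<open>(z\<^sub>k, x\<^sub>k)\<close>.\<close>

primrec accbio ::
  "(real^'p \<Rightarrow> real^'q \<Rightarrow> real) \<Rightarrow> (real^'p \<Rightarrow> real^'q \<Rightarrow> real) \<Rightarrow> real \<Rightarrow> real \<Rightarrow> real \<Rightarrow> real
    \<Rightarrow> real \<Rightarrow> real \<Rightarrow> nat \<Rightarrow> nat \<Rightarrow> nat \<Rightarrow> (real^'p) \<times> (real^'p)" where
  "accbio f g L_\<Phi> \<mu>_x Lt_y \<mu>_y lam \<theta> N M 0 = (0, 0)"
| "accbio f g L_\<Phi> \<mu>_x Lt_y \<mu>_y lam \<theta> N M (Suc k) =
    (let (z, x) = accbio f g L_\<Phi> \<mu>_x Lt_y \<mu>_y lam \<theta> N M k;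
         \<kappa> = L_\<Phi> / \<mu>_x;
         \<beta> = (sqrt \<kappa> - 1) / (sqrt \<kappa> + 1);
         z' = x - (1 / L_\<Phi>) *\<^sub>R hypergrad_estimate f g Lt_y \<mu>_y lam \<theta> N M x
     in (z', (1 + \<beta>) *\<^sub>R z' - \<beta> *\<^sub>R z))"

definition accbio_z ::
  "(real^'p \<Rightarrow> real^'q \<Rightarrow> real) \<Rightarrow> (real^'p \<Rightarrow> real^'q \<Rightarrow> real) \<Rightarrow> real \<Rightarrow> real \<Rightarrow> real \<Rightarrow> real
    \<Rightarrow> real \<Rightarrow> real \<Rightarrow> nat \<Rightarrow> nat \<Rightarrow> nat \<Rightarrow> real^'p" where
  "accbio_z f g L_\<Phi> \<mu>_x Lt_y \<mu>_y lam \<theta> N M k = fst (accbio f g L_\<Phi> \<mu>_x Lt_y \<mu>_y lam \<theta> N M k)"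


section \<open>Complexity\<close>

text \<open>One outer iteration uses one Jacobian-vector product (in the hypergradient estimate), one
  Hessian-vector product for each of the \<open>M\<close> heavy-ball steps, \<open>N\<close> evaluations of the
  \<open>y\<close>-gradient of \<open>g\<close>, and one evaluation of each partial gradient of \<open>f\<close>.\<close>

definition n_J :: "nat \<Rightarrow> nat" where "n_J K = K"
definition n_H :: "nat \<Rightarrow> nat \<Rightarrow> nat" where "n_H M K = K * M"
definition n_G :: "nat \<Rightarrow> nat \<Rightarrow> nat" where "n_G N K = K * (N + 2)"

text \<open>The cost of the cheapest run whose number \<open>K\<close> of outer iterations meets the goal;
  it is \<open>\<infinity>\<close> if no run does.\<close>

definition complexity :: "real \<Rightarrow> nat \<Rightarrow> nat \<Rightarrow> (nat \<Rightarrow> bool) \<Rightarrow> ereal" where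
  "complexity \<tau> N M goal =
    (INF K\<in>{K. goal K}. ereal (\<tau> * (real (n_J K) + real (n_H M K)) + real (n_G N K)))"

definition C_sub ::
  "real \<Rightarrow> nat \<Rightarrow> nat \<Rightarrow> ('a \<Rightarrow> real) \<Rightarrow> 'a \<Rightarrow> (nat \<Rightarrow> 'a) \<Rightarrow> real \<Rightarrow> ereal" where
  "C_sub \<tau> N M \<Phi> xs z \<epsilon> = complexity \<tau> N M (\<lambda>K. \<Phi> (z K) - \<Phi> xs \<le> \<epsilon>)"

definition C_norm ::
  "real \<Rightarrow> nat \<Rightarrow> nat \<Rightarrow> ('a::real_inner \<Rightarrow> real) \<Rightarrow> (nat \<Rightarrow> 'a) \<Rightarrow> real \<Rightarrow> ereal" where
  "C_norm \<tau> N M \<Phi> z \<epsilon> = complexity \<tau> N M (\<lambda>K. norm (grad \<Phi> (z K)) \<le> \<epsilon>)"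


section \<open>Order notation\<close>

text \<open>The hidden constants must not depend on the dimensions \<open>p\<close> and \<open>q\<close>. As these are types,
  an existentially quantified constant inside the theorem could depend on them, so the constant is
  a fixed function of \<open>L_x, L_xy, L_y, Lt_xy\<close>. Its numerical value is immaterial and
  generous. The parameter \<open>\<rho>\<close> is an arbitrary upper bound on \<open>\<mu>_y\<close> and
  \<open>\<mu>_x = \<epsilon> / R\<close>: the order notation concerns these parameters tending to 0.\<close>

definition hidden_const :: "real \<Rightarrow> real \<Rightarrow> real \<Rightarrow> real \<Rightarrow> real \<Rightarrow> real" where
  "hidden_const \<rho> L_x L_xy L_y Lt_xy = (10 * (1 + \<rho> + L_x + L_xy + L_y + Lt_xy)) ^ 10"

text \<open>Factors hidden by the tilde. The last two arguments stand for the norms of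
  \<open>y\<^sup>*(x\<^sup>*)\<close> and of the \<open>y\<close>-gradient of \<open>f\<close> at \<open>(x\<^sup>*, y\<^sup>*(x\<^sup>*))\<close>.\<close>

definition log_factor :: "real \<Rightarrow> real \<Rightarrow> real \<Rightarrow> real \<Rightarrow> real \<Rightarrow> real \<Rightarrow> real" where
  "log_factor \<epsilon> \<mu>_y Lt_y B Y G = ln (3 + 1 / \<epsilon> + 1 / \<mu>_y + Lt_y + B + Y + G)"

definition same_order :: "real \<Rightarrow> real \<Rightarrow> real \<Rightarrow> bool" where
  "same_order C a b \<longleftrightarrow> b / C \<le> a \<and> a \<le> C * b"

end

theory Submission
  imports Defs
begin

text \<open>
  The outer loop is Nesterov's method for the strongly convex function
  \<open>F x = \<Phi> x + (\<epsilon> / 2R) \<parallel>x\<parallel>\<^sup>2\<close>, run with inexact gradients. With \<open>q = \<surd>(\<mu> / L)\<close> and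
  \<open>w = x + (x - z) / q\<close>, the function \<open>F z - min F + \<mu>/2 \<parallel>w - x\<^sup>o\<parallel>\<^sup>2\<close> contracts by \<open>1 - q/2\<close> per
  step up to a multiple of the squared gradient error. That error grows at most linearly in
  \<open>\<parallel>x - x\<^sup>o\<parallel>\<close>, so once its coefficient is polynomially small it costs only half of the
  contraction; the same estimate without error treats the inner loop.

  The heavy-ball error satisfies \<open>u (t + 2) = 2 A (u (t + 1)) - r\<^sup>2 u t\<close> with \<open>A\<close> symmetric and
  \<open>\<parallel>A\<parallel> \<le> r\<close>, which is a Chebyshev recursion; Pell's identity for Chebyshev polynomials becomes a
  quadratic invariant that bounds \<open>u t\<close> by a multiple of \<open>t r\<^bsup>t-1\<^esup>\<close> without any diagonalization.

  In the gradient-norm case the regularization term already contributes \<open>(\<epsilon> / B) \<parallel>x\<^sup>o\<parallel>\<close>. This is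
  below \<open>\<epsilon>\<close> by a polynomially small amount, because smoothness of \<open>\<Phi>\<close> forces
  \<open>\<parallel>x\<^sup>o\<parallel> \<le> B / (1 + \<epsilon> / 2BL)\<close>; an accuracy better than this margin costs only logarithms.
\<close>

section \<open>Accelerated gradient descent with inexact gradients\<close>

text \<open>The gradient field enters through the two quadratic bounds only, so one analysis serves
  \<open>g x\<close> in the inner loop and the regularized hyperobjective in the outer loop.
  \<open>q\<close> is the inverse square root of the condition number.\<close>

locale nesterov_objective =
  fixes F :: "'a::real_inner \<Rightarrow> real" and dF :: "'a \<Rightarrow> 'a" and L \<mu> q :: real and xo :: 'a
  assumes mu_pos: "0 < \<mu>" and mu_le: "\<mu> \<le> L"
    and lower: "\<And>u v. F v + dF v \<bullet> (u - v) + \<mu> / 2 * (norm (u - v))\<^sup>2 \<le> F u"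
    and upper: "\<And>u v. F u \<le> F v + dF v \<bullet> (u - v) + L / 2 * (norm (u - v))\<^sup>2"
    and minimal: "\<And>u. F xo \<le> F u"
    and q_def: "q = sqrt (\<mu> / L)"
begin

lemma L_pos: "0 < L"
  using mu_pos mu_le by linarith

lemma q_pos: "0 < q" and q_le_1: "q \<le> 1" and mu_eq: "\<mu> = q\<^sup>2 * L"
  using mu_pos mu_le L_pos by (auto simp: q_def)

text \<open>With step length \<open>1 / L\<close> the linear and quadratic terms of the upper bound
  complete a square, so an inexact gradient \<open>G\<close> costs only the square of its
  error.\<close>

lemma gradient_step:
  "F (x - (1 / L) *\<^sub>R G) \<le> F x - (norm (dF x))\<^sup>2 / (2 * L) + (norm (G - dF x))\<^sup>2 / (2 * L)"
proof -
  have "F (x - (1 / L) *\<^sub>R G) \<le> F x + dF x \<bullet> (- (1 / L) *\<^sub>R G) + L / 2 * (norm (- (1 / L) *\<^sub>R G))\<^sup>2"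
    using upper[of "x - (1 / L) *\<^sub>R G" x] by simp
  also have "\<dots> = F x - (norm (dF x))\<^sup>2 / (2 * L) + (norm (G - dF x))\<^sup>2 / (2 * L)"
    using L_pos unfolding power2_norm_eq_inner
    by (simp add: inner_simps inner_commute field_simps power2_eq_square)
  finally show ?thesis .
qed

lemma gradient_bound: "(norm (dF x))\<^sup>2 / (2 * L) \<le> F x - F xo"
  using gradient_step[of x "dF x"] minimal[of "x - (1 / L) *\<^sub>R dF x"] by simp

lemma gradient_xo: "dF xo = 0"
  using gradient_bound[of xo] L_pos by (simp add: divide_le_0_iff)

lemma quadratic_growth: "\<mu> / 2 * (norm (u - xo))\<^sup>2 \<le> F u - F xo"
  using lower[of xo u] gradient_xo by simp

lemma quadratic_bound: "F u - F xo \<le> L / 2 * (norm (u - xo))\<^sup>2"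
  using upper[of u xo] gradient_xo by simp

text \<open>The lower bound at \<open>x\<close> is tested at \<open>z\<close> with weight
  \<open>1 - q\<close> and at \<open>xo\<close> with weight \<open>q\<close>. The linear terms then
  add up to the cross term \<open>q * (dF x \<bullet> m)\<close> of the squared distance and cancel;
  the remaining squared gradient is paid for by the decrease of a gradient step.\<close>

lemma lyapunov_step_exact:
  assumes x: "(1 + q) *\<^sub>R x = z + q *\<^sub>R w"
  shows "F x - F xo - (norm (dF x))\<^sup>2 / (2 * L)
      + \<mu> / 2 * (norm ((1 - q) *\<^sub>R w + q *\<^sub>R x - (1 / (q * L)) *\<^sub>R dF x - xo))\<^sup>2
    \<le> (1 - q) * (F z - F xo + \<mu> / 2 * (norm (w - xo))\<^sup>2)"
proof -
  define d p m where "d = w - xo" and "p = x - xo" and "m = (1 - q) *\<^sub>R d + q *\<^sub>R p"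
  have "x - z = q *\<^sub>R (w - x)"
    using x by (simp add: algebra_simps)
  then have zx: "z - x = - (q *\<^sub>R (d - p))"
    by (simp add: d_def p_def algebra_simps)
  have "F x - F z \<le> q * (dF x \<bullet> (d - p)) - \<mu> / 2 * (norm (z - x))\<^sup>2"
    using lower[of x z] unfolding zx by simp
  also have "\<dots> \<le> q * (dF x \<bullet> (d - p))"
    using mu_pos by simp
  finally have 1: "(1 - q) * (F x - F z) \<le> (1 - q) * (q * (dF x \<bullet> (d - p)))"
    using q_le_1 by (intro mult_left_mono) auto
  have "F x - F xo \<le> dF x \<bullet> p - \<mu> / 2 * (norm p)\<^sup>2"
    using lower[of x xo] unfolding p_def by (simp add: inner_simps norm_minus_commute)
  then have 2: "q * (F x - F xo) \<le> q * (dF x \<bullet> p - \<mu> / 2 * (norm p)\<^sup>2)"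
    using q_pos by (intro mult_left_mono) auto
  \<comment> \<open>Variance identity for the convex combination \<open>m\<close> of
    \<open>d\<close> and \<open>p\<close>; the variance term has a favourable sign.\<close>
  have "(norm m)\<^sup>2 = (1 - q) * (norm d)\<^sup>2 + q * (norm p)\<^sup>2 - q * (1 - q) * (norm (d - p))\<^sup>2"
    unfolding m_def power2_norm_eq_inner by (simp add: inner_simps inner_commute algebra_simps power2_eq_square)
  moreover have "0 \<le> q * (1 - q) * (norm (d - p))\<^sup>2"
    using q_pos q_le_1 by simp
  ultimately have "(norm m)\<^sup>2 \<le> (1 - q) * (norm d)\<^sup>2 + q * (norm p)\<^sup>2"
    by linarith
  then have "\<mu> / 2 * (norm m)\<^sup>2 \<le> \<mu> / 2 * ((1 - q) * (norm d)\<^sup>2 + q * (norm p)\<^sup>2)"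
    using mu_pos by (intro mult_left_mono) auto
  also have "\<dots> = (1 - q) * (\<mu> / 2 * (norm d)\<^sup>2) + q * (\<mu> / 2 * (norm p)\<^sup>2)"
    by (simp add: field_simps)
  finally have 3: "\<mu> / 2 * (norm m)\<^sup>2 \<le> (1 - q) * (\<mu> / 2 * (norm d)\<^sup>2) + q * (\<mu> / 2 * (norm p)\<^sup>2)" .
  have eq: "(1 - q) *\<^sub>R w + q *\<^sub>R x - (1 / (q * L)) *\<^sub>R dF x - xo = m - (1 / (q * L)) *\<^sub>R dF x"
    by (simp add: m_def d_def p_def algebra_simps)
  have "(norm (m - (1 / (q * L)) *\<^sub>R dF x))\<^sup>2
      = (norm m)\<^sup>2 - 2 / (q * L) * (dF x \<bullet> m) + (norm (dF x))\<^sup>2 / (q * L)\<^sup>2"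
    unfolding power2_norm_eq_inner by (simp add: inner_simps inner_commute power2_eq_square)
  then have 4: "\<mu> / 2 * (norm (m - (1 / (q * L)) *\<^sub>R dF x))\<^sup>2
      = \<mu> / 2 * (norm m)\<^sup>2 - q * (dF x \<bullet> m) + (norm (dF x))\<^sup>2 / (2 * L)"
    using q_pos L_pos by (simp add: mu_eq field_simps power2_eq_square)
  have 5: "q * (dF x \<bullet> m) = (1 - q) * (q * (dF x \<bullet> (d - p))) + q * (dF x \<bullet> p)"
    by (simp add: m_def inner_simps algebra_simps)
  have 6: "F x - F xo = (1 - q) * (F x - F z) + q * (F x - F xo) + (1 - q) * (F z - F xo)"
    by (simp add: algebra_simps)
  show ?thesis
    unfolding eq d_def[symmetric] distrib_left[of "1 - q"]
    using 1 2[unfolded right_diff_distrib[of q "dF x \<bullet> p"]] 3 4 5 6 by linarith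
qed

text \<open>Young's inequality with weight \<open>q / 2\<close> separates the error from the exact
  step. Since \<open>(1 + q / 2) * (1 - q) \<le> 1 - q / 2\<close>, this gives up half of the
  contraction. The gap \<open>D\<close> is nonnegative, so it can be carried along under the factor
  \<open>1 + q / 2\<close>.\<close>

lemma lyapunov_step:
  assumes x: "(1 + q) *\<^sub>R x = z + q *\<^sub>R w"
  shows "F (x - (1 / L) *\<^sub>R G) - F xo
      + \<mu> / 2 * (norm ((1 - q) *\<^sub>R w + q *\<^sub>R x - (1 / (q * L)) *\<^sub>R G - xo))\<^sup>2
    \<le> (1 - q / 2) * (F z - F xo + \<mu> / 2 * (norm (w - xo))\<^sup>2) + 2 / (q * L) * (norm (G - dF x))\<^sup>2"
proof -
  define e where "e = G - dF x"
  define u where "u = (1 - q) *\<^sub>R w + q *\<^sub>R x - (1 / (q * L)) *\<^sub>R dF x - xo"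
  define E where "E = F z - F xo + \<mu> / 2 * (norm (w - xo))\<^sup>2"
  have E0: "0 \<le> E" using minimal[of z] mu_pos by (simp add: E_def)
  have eq: "(1 - q) *\<^sub>R w + q *\<^sub>R x - (1 / (q * L)) *\<^sub>R G - xo = u - (1 / (q * L)) *\<^sub>R e"
    by (simp add: u_def e_def algebra_simps)
  define n where "n = (1 / (q * L)) *\<^sub>R e"
  \<comment> \<open>Young's inequality, obtained by expanding a square whose mixed term is twice the
    inner product of \<open>u\<close> and \<open>n\<close>.\<close>
  have "0 \<le> (norm (q *\<^sub>R u + 2 *\<^sub>R n))\<^sup>2 / (2 * q)"
    using q_pos by simp
  also have "(norm (q *\<^sub>R u + 2 *\<^sub>R n))\<^sup>2 = q * (q * (norm u)\<^sup>2) + q * (4 * (u \<bullet> n)) + 4 * (norm n)\<^sup>2"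
    unfolding power2_norm_eq_inner by (simp add: inner_simps inner_commute)
  also have "\<dots> / (2 * q) = q / 2 * (norm u)\<^sup>2 + 2 * (u \<bullet> n) + 2 / q * (norm n)\<^sup>2"
    using q_pos by (simp add: add_divide_distrib)
  finally have "(norm (u - n))\<^sup>2 \<le> (1 + q / 2) * (norm u)\<^sup>2 + (1 + 2 / q) * (norm n)\<^sup>2"
    unfolding power2_norm_eq_inner by (simp add: inner_simps inner_commute algebra_simps)
  then have "\<mu> / 2 * (norm (u - n))\<^sup>2 \<le> \<mu> / 2 * ((1 + q / 2) * (norm u)\<^sup>2 + (1 + 2 / q) * (norm n)\<^sup>2)"
    using mu_pos by (intro mult_left_mono) auto
  also have "(norm n)\<^sup>2 = (norm e)\<^sup>2 / (q * L)\<^sup>2"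
    by (simp add: n_def power_mult_distrib power_divide)
  also have "\<mu> / 2 * ((1 + q / 2) * (norm u)\<^sup>2 + (1 + 2 / q) * ((norm e)\<^sup>2 / (q * L)\<^sup>2))
      = (1 + q / 2) * (\<mu> / 2 * (norm u)\<^sup>2) + (1 + 2 / q) / (2 * L) * (norm e)\<^sup>2"
    using q_pos L_pos by (simp add: mu_eq field_simps power2_eq_square)
  finally have 1: "\<mu> / 2 * (norm (u - n))\<^sup>2
      \<le> (1 + q / 2) * (\<mu> / 2 * (norm u)\<^sup>2) + (1 + 2 / q) / (2 * L) * (norm e)\<^sup>2" .
  define D where "D = F x - F xo - (norm (dF x))\<^sup>2 / (2 * L)"
  have D: "0 \<le> D" using gradient_bound[of x] by (simp add: D_def)
  have "D + \<mu> / 2 * (norm u)\<^sup>2 \<le> (1 - q) * E"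
    using lyapunov_step_exact[OF x] by (simp add: u_def E_def D_def)
  then have "(1 + q / 2) * (D + \<mu> / 2 * (norm u)\<^sup>2) \<le> (1 + q / 2) * ((1 - q) * E)"
    using q_pos by (intro mult_left_mono) auto
  also have "\<dots> = (1 - q / 2) * E - q\<^sup>2 / 2 * E" by (simp add: field_simps power2_eq_square)
  also have "\<dots> \<le> (1 - q / 2) * E" using E0 by simp
  finally have "(1 + q / 2) * D + (1 + q / 2) * (\<mu> / 2 * (norm u)\<^sup>2) \<le> (1 - q / 2) * E"
    by (simp only: distrib_left)
  moreover have "D \<le> (1 + q / 2) * D"
    using mult_right_mono[of 1 "1 + q / 2" D] D q_pos by simp
  ultimately have 2: "D + (1 + q / 2) * (\<mu> / 2 * (norm u)\<^sup>2) \<le> (1 - q / 2) * E"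
    by linarith
  have "(norm e)\<^sup>2 / (2 * L) + (1 + 2 / q) / (2 * L) * (norm e)\<^sup>2 = (q + 1) / (q * L) * (norm e)\<^sup>2"
    using q_pos L_pos by (simp add: field_simps)
  also have "\<dots> \<le> 2 / (q * L) * (norm e)\<^sup>2"
    using q_pos L_pos q_le_1 by (intro mult_right_mono divide_right_mono) auto
  finally show ?thesis
    using 1 2 gradient_step[of x G]
    unfolding eq n_def[symmetric] E_def[symmetric] e_def[symmetric] D_def by linarith
qed

text \<open>The squared error splits into a part proportional to the Lyapunov value
  \<open>E k\<close> and a constant part. The first condition on \<open>\<zeta>\<close> bounds the
  former by \<open>q / 4 * E k\<close>, which leaves the rate \<open>1 - q / 4\<close>; the second
  bounds the latter by \<open>q / 4 * \<eta>\<close>, and these contributions sum to at most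
  \<open>\<eta>\<close>.\<close>

theorem inexact_nesterov:
  fixes z x G :: "nat \<Rightarrow> 'a"
  assumes init: "x 0 = z 0"
    and z: "\<And>k. z (Suc k) = x k - (1 / L) *\<^sub>R G k"
    and x: "\<And>k. x (Suc k) = (1 + (1 - q) / (1 + q)) *\<^sub>R z (Suc k) - ((1 - q) / (1 + q)) *\<^sub>R z k"
    and err: "\<And>k. norm (G k - dF (x k)) \<le> \<zeta> * (1 + norm (x k - xo))"
    and \<zeta>: "32 * \<zeta>\<^sup>2 \<le> \<mu>\<^sup>2" "16 * \<zeta>\<^sup>2 \<le> \<mu> * \<eta>"
  shows "F (z k) - F xo \<le> (1 - q / 4) ^ k * (L * (norm (z 0 - xo))\<^sup>2) + \<eta>"
proof -
  \<comment> \<open>Extrapolation of the momentum: \<open>w k\<close> is the point for which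
    \<open>x k\<close> divides the segment from \<open>z k\<close> to \<open>w k\<close> with
    weights proportional to \<open>1\<close> and \<open>q\<close>, as \<open>lyapunov_step\<close>
    requires.\<close>
  define w where "w k = x k + (1 / q) *\<^sub>R (x k - z k)" for k
  have w: "(1 + q) *\<^sub>R x k = z k + q *\<^sub>R w k" for k
    using q_pos by (simp add: w_def algebra_simps)
  have w_Suc: "w (Suc k) = (1 - q) *\<^sub>R w k + q *\<^sub>R x k - (1 / (q * L)) *\<^sub>R G k" for k
  proof -
    have "q *\<^sub>R w (Suc k) = (1 + q) *\<^sub>R x (Suc k) - z (Suc k)"
      using w[of "Suc k"] by simp
    also have "(1 + q) *\<^sub>R x (Suc k) = 2 *\<^sub>R z (Suc k) - (1 - q) *\<^sub>R z k"
    proof -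
      have "(1 + q) * (1 + (1 - q) / (1 + q)) = 2" "(1 + q) * ((1 - q) / (1 + q)) = 1 - q"
        using q_pos by (simp_all add: field_simps)
      then show ?thesis unfolding x scaleR_diff_right scaleR_scaleR by (simp only:)
    qed
    also have "2 *\<^sub>R z (Suc k) - (1 - q) *\<^sub>R z k - z (Suc k) = z (Suc k) - (1 - q) *\<^sub>R z k"
      by (simp add: algebra_simps scaleR_2)
    also have "z k = (1 + q) *\<^sub>R x k - q *\<^sub>R w k"
      using w[of k] by simp
    also have "z (Suc k) - (1 - q) *\<^sub>R ((1 + q) *\<^sub>R x k - q *\<^sub>R w k)
       = q *\<^sub>R ((1 - q) *\<^sub>R w k + q *\<^sub>R x k - (1 / (q * L)) *\<^sub>R G k)"
      using q_pos by (simp add: z algebra_simps)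
    finally show ?thesis using q_pos by simp
  qed
  define E where "E k = F (z k) - F xo + \<mu> / 2 * (norm (w k - xo))\<^sup>2" for k
  \<comment> \<open>Since \<open>x k\<close> lies between \<open>z k\<close> and \<open>w k\<close>,
    it is no farther from \<open>xo\<close> than the worse of the two. \<open>E k\<close> controls
    both distances, one by quadratic growth and one by definition.\<close>
  have x_dist: "\<mu> / 2 * (norm (x k - xo))\<^sup>2 \<le> E k" for k
  proof -
    have "(1 + q) *\<^sub>R (x k - xo) = (z k - xo) + q *\<^sub>R (w k - xo)"
      using w[of k] by (simp add: algebra_simps)
    then have "x k - xo = (1 / (1 + q)) *\<^sub>R ((z k - xo) + q *\<^sub>R (w k - xo))"
      using q_pos by (simp add: eq_vector_fraction_iff)
    then have xk: "x k - xo = (1 / (1 + q)) *\<^sub>R (z k - xo) + (q / (1 + q)) *\<^sub>R (w k - xo)"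
      by (simp add: scaleR_add_right)
    have "norm (x k - xo) \<le> 1 / (1 + q) * norm (z k - xo) + q / (1 + q) * norm (w k - xo)"
      unfolding xk using q_pos by (intro norm_triangle_le) simp
    also have "\<dots> \<le> 1 / (1 + q) * max (norm (z k - xo)) (norm (w k - xo))
        + q / (1 + q) * max (norm (z k - xo)) (norm (w k - xo))"
      using q_pos by (intro add_mono mult_left_mono) auto
    also have "\<dots> = (1 / (1 + q) + q / (1 + q)) * max (norm (z k - xo)) (norm (w k - xo))"
      by (rule distrib_right[symmetric])
    also have "1 / (1 + q) + q / (1 + q) = 1"
      using q_pos by (simp add: field_simps)
    finally have "norm (x k - xo) \<le> max (norm (z k - xo)) (norm (w k - xo))"
      by (simp only: mult_1_left)
    then have "(norm (x k - xo))\<^sup>2 \<le> (max (norm (z k - xo)) (norm (w k - xo)))\<^sup>2"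
      by (rule power_mono) (rule norm_ge_zero)
    also have "\<dots> \<le> (norm (z k - xo))\<^sup>2 + (norm (w k - xo))\<^sup>2"
      by (simp add: max_def)
    finally have "\<mu> / 2 * (norm (x k - xo))\<^sup>2 \<le> \<mu> / 2 * ((norm (z k - xo))\<^sup>2 + (norm (w k - xo))\<^sup>2)"
      using mu_pos by (intro mult_left_mono) auto
    then show ?thesis
      using quadratic_growth[of "z k"] by (simp add: E_def algebra_simps)
  qed
  have E_nonneg: "0 \<le> E k" for k
    using minimal[of "z k"] mu_pos by (simp add: E_def)
  have step: "E (Suc k) \<le> (1 - q / 4) * E k + q / 4 * \<eta>" for k
  proof -
    define n where "n = norm (x k - xo)"
    have "(norm (G k - dF (x k)))\<^sup>2 \<le> (\<zeta> * (1 + n))\<^sup>2"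
      using err[of k] by (intro power_mono) (auto simp: n_def)
    also have "\<dots> \<le> \<zeta>\<^sup>2 * (2 + 2 * n\<^sup>2)"
      unfolding power_mult_distrib
      using sum_squares_ge_zero[of "1 - n" 0] by (intro mult_left_mono) (auto simp: power2_eq_square algebra_simps)
    also have "\<dots> = 2 * \<zeta>\<^sup>2 + 4 / \<mu> * \<zeta>\<^sup>2 * (\<mu> / 2 * n\<^sup>2)"
      using mu_pos by (simp add: field_simps)
    also have "\<dots> \<le> 2 * \<zeta>\<^sup>2 + 4 / \<mu> * \<zeta>\<^sup>2 * E k"
      using mu_pos x_dist[of k] by (intro add_mono mult_left_mono) (auto simp: n_def)
    finally have "2 / (q * L) * (norm (G k - dF (x k)))\<^sup>2 \<le> 2 / (q * L) * (2 * \<zeta>\<^sup>2 + 4 / \<mu> * \<zeta>\<^sup>2 * E k)"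
      using q_pos L_pos by (intro mult_left_mono) auto
    also have "\<dots> = q / (4 * \<mu>) * (16 * \<zeta>\<^sup>2) + q / (4 * \<mu>\<^sup>2) * E k * (32 * \<zeta>\<^sup>2)"
      using q_pos L_pos by (simp add: mu_eq field_simps power2_eq_square)
    also have "\<dots> \<le> q / (4 * \<mu>) * (\<mu> * \<eta>) + q / (4 * \<mu>\<^sup>2) * E k * \<mu>\<^sup>2"
      using \<zeta> q_pos mu_pos E_nonneg[of k] by (intro add_mono mult_left_mono) auto
    also have "\<dots> = q / 4 * \<eta> + q / 4 * E k"
      using mu_pos by (simp add: field_simps)
    finally show ?thesis
      using lyapunov_step[OF w, of k "G k"] unfolding z[symmetric] w_Suc[symmetric] E_def[symmetric]
      by argo
  qed
  have bound: "E k \<le> (1 - q / 4) ^ k * E 0 + (1 - (1 - q / 4) ^ k) * \<eta>"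
  proof (induction k)
    case (Suc k)
    have "(1 - q / 4) * E k \<le> (1 - q / 4) * ((1 - q / 4) ^ k * E 0 + (1 - (1 - q / 4) ^ k) * \<eta>)"
      using Suc q_le_1 by (intro mult_left_mono) auto
    also have "\<dots> = (1 - q / 4) ^ Suc k * E 0 + (1 - q / 4) * \<eta> - (1 - q / 4) ^ Suc k * \<eta>"
      by (simp add: algebra_simps)
    finally show ?case using step[of k] by (simp only: left_diff_distrib)
  qed simp
  have noise: "(1 - (1 - q / 4) ^ k) * \<eta> \<le> 1 * \<eta>"
  proof (rule mult_right_mono)
    have "0 \<le> \<mu> * \<eta>" using \<zeta>(2) by (smt (verit) zero_le_power2)
    then show "0 \<le> \<eta>" using mu_pos by (simp add: zero_le_mult_iff)
  qed (use q_le_1 in auto)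
  have "E 0 \<le> L * (norm (z 0 - xo))\<^sup>2"
  proof -
    have "\<mu> / 2 * (norm (z 0 - xo))\<^sup>2 \<le> L / 2 * (norm (z 0 - xo))\<^sup>2"
      using mu_le by (intro mult_right_mono) auto
    then show ?thesis
      using quadratic_bound[of "z 0"] by (simp add: E_def w_def init)
  qed
  then have "(1 - q / 4) ^ k * E 0 \<le> (1 - q / 4) ^ k * (L * (norm (z 0 - xo))\<^sup>2)"
    using q_le_1 by (intro mult_left_mono) auto
  moreover have "F (z k) - F xo \<le> E k"
    using mu_pos by (simp add: E_def)
  moreover note bound noise
  ultimately show ?thesis
    by linarith
qed

end

section \<open>The heavy-ball method on quadratic functions\<close>

text \<open>Writing \<open>u (Suc t) = A (u t) + c t\<close> with \<open>c t\<close> of order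
  \<open>r ^ t\<close>, every step adds one more term of size \<open>r ^ t\<close>, whence the
  linear factor. It reflects critical damping: where \<open>A\<close> acts as \<open>r\<close>, the
  characteristic polynomial has the double root \<open>r\<close>.\<close>

theorem heavy_ball_recursion:
  fixes A :: "'a::real_inner \<Rightarrow> 'a" and u :: "nat \<Rightarrow> 'a"
  assumes A: "linear A" "\<And>v w. A v \<bullet> w = v \<bullet> A w" "\<And>v. norm (A v) \<le> r * norm v"
    and r: "0 \<le> r" "r \<le> 1"
    and init: "u 0 = a" "u (Suc 0) = a"
    and rec: "\<And>t. u (Suc (Suc t)) = 2 *\<^sub>R A (u (Suc t)) - r\<^sup>2 *\<^sub>R u t"
  shows "norm (u (Suc t)) \<le> (r ^ Suc t + 3 * real (Suc t) * r ^ t) * norm a"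
proof -
  define c where "c t = u (Suc t) - A (u t)" for t
  \<comment> \<open>In the scalar case with \<open>r = 1\<close>, \<open>u\<close> and
    \<open>c\<close> play the roles of Chebyshev polynomials of the second and first kind, and this
    is the form in Pell's identity \<open>T_n^2 + (1 - x^2) * U_(n-1)^2 = 1\<close>. The bracket is
    nonnegative by the norm bound on \<open>A\<close>, so \<open>I t\<close> dominates the square of
    \<open>c t\<close>.\<close>
  define I where "I t = (norm (c t))\<^sup>2 + (r\<^sup>2 * (norm (u t))\<^sup>2 - (norm (A (u t)))\<^sup>2)" for t
  have A_sq: "(norm (A v))\<^sup>2 \<le> r\<^sup>2 * (norm v)\<^sup>2" for v
    using power_mono[OF A(3)[of v], of 2] by (simp add: power_mult_distrib)
  have I_Suc: "I (Suc t) = r\<^sup>2 * I t" for t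
  proof -
    interpret linear A by fact
    define v Av AAv d Ad where "v = u t" and "Av = A v" and "AAv = A Av" and "d = c t" and "Ad = A d"
    have u': "u (Suc t) = d + Av" by (simp add: d_def c_def v_def Av_def)
    have c': "c (Suc t) = Ad - r\<^sup>2 *\<^sub>R v + AAv"
      by (simp add: c_def[of "Suc t"] rec u' add scaleR_2 v_def[symmetric] Ad_def AAv_def)
    have "AAv \<bullet> v = Av \<bullet> Av" "Ad \<bullet> v = d \<bullet> Av"
      by (simp_all add: AAv_def Av_def Ad_def A(2))
    then show ?thesis
      unfolding I_def c' u' add Av_def[symmetric] AAv_def[symmetric] Ad_def[symmetric] d_def[symmetric] v_def[symmetric]
        power2_norm_eq_inner
      by (simp add: inner_simps inner_commute algebra_simps power2_eq_square)
  qed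
  have I: "I t = r ^ (2 * t) * I 0" for t
    by (induction t) (simp_all add: I_Suc power2_eq_square)
  have "norm (c 0) \<le> norm a + r * norm a"
    unfolding c_def init using A(3)[of a] norm_triangle_ineq4[of a "A a"] by simp
  also have "\<dots> \<le> norm a + 1 * norm a"
    using r by (intro add_left_mono mult_right_mono) auto
  finally have "(norm (c 0))\<^sup>2 \<le> (2 * norm a)\<^sup>2"
    by (intro power_mono) auto
  moreover have "r\<^sup>2 * (norm a)\<^sup>2 \<le> 1 * (norm a)\<^sup>2"
    using r by (intro mult_right_mono) (auto simp: power_le_one)
  \<comment> \<open>The two contributions give \<open>2^2 + 1\<close>, rounded up to
    \<open>3^2\<close>; this is the source of the factor 3.\<close>
  ultimately have I0: "I 0 \<le> (3 * norm a)\<^sup>2"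
    unfolding I_def init by (simp add: power_mult_distrib) (smt (verit) zero_le_power2)
  have c: "norm (c t) \<le> 3 * r ^ t * norm a" for t
  proof (rule power2_le_imp_le)
    have "(norm (c t))\<^sup>2 \<le> I t" using A_sq[of "u t"] by (simp add: I_def)
    also have "\<dots> \<le> r ^ (2 * t) * (3 * norm a)\<^sup>2"
      unfolding I[of t] using I0 r by (intro mult_left_mono) auto
    also have "\<dots> = (3 * r ^ t * norm a)\<^sup>2"
      by (simp add: power_mult_distrib power_mult mult.commute flip: power_mult)
    finally show "(norm (c t))\<^sup>2 \<le> (3 * r ^ t * norm a)\<^sup>2" .
  qed (use r in simp)
  have u_Suc: "norm (u (Suc t)) \<le> r * norm (u t) + 3 * r ^ t * norm a" for t
  proof -
    have "u (Suc t) = A (u t) + c t" by (simp add: c_def)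
    then show ?thesis
      using norm_triangle_ineq[of "A (u t)" "c t"] A(3)[of "u t"] c[of t] by simp
  qed
  show ?thesis
  proof (induction t)
    case 0
    then show ?case using u_Suc[of 0] init by (simp add: algebra_simps)
  next
    case (Suc t)
    have "r * norm (u (Suc t)) \<le> r * ((r ^ Suc t + 3 * real (Suc t) * r ^ t) * norm a)"
      using Suc r by (intro mult_left_mono) auto
    then show ?case using u_Suc[of "Suc t"] by (simp add: algebra_simps)
  qed
qed

text \<open>Polarization with \<open>w\<close>, the vector \<open>A v\<close> rescaled to the length
  of \<open>v\<close>, expresses \<open>A v \<bullet> w\<close> by two values of the form, and the
  parallelogram law bounds their sum. No eigenvectors are involved.\<close>

lemma symmetric_form_bound:
  fixes A :: "'a::real_inner \<Rightarrow> 'a"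
  assumes A: "linear A" "\<And>v w. A v \<bullet> w = v \<bullet> A w" and form: "\<And>v. \<bar>v \<bullet> A v\<bar> \<le> r * (norm v)\<^sup>2"
  shows "norm (A v) \<le> r * norm v"
proof (cases "A v = 0 \<or> v = 0")
  case True
  have "0 \<le> r" if "v \<noteq> 0"
    using form[of v] that by (smt (verit) mult_neg_pos zero_less_norm_iff zero_less_power)
  then show ?thesis using True A(1) by (cases "v = 0") (auto simp: linear_0)
next
  case False
  interpret linear A by fact
  define w where "w = (norm v / norm (A v)) *\<^sub>R A v"
  have nw: "norm w = norm v" using False by (simp add: w_def)
  have "4 * (A v \<bullet> w) = (v + w) \<bullet> A (v + w) - (v - w) \<bullet> A (v - w)"
    using A(2)[of v w] inner_commute[of w "A v"] by (simp add: add diff inner_simps)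
  also have "\<dots> \<le> r * (norm (v + w))\<^sup>2 + r * (norm (v - w))\<^sup>2"
    using form[of "v + w"] form[of "v - w"] by linarith
  also have "\<dots> = r * (2 * (norm v)\<^sup>2 + 2 * (norm w)\<^sup>2)"
    unfolding power2_norm_eq_inner by (simp add: inner_simps inner_commute algebra_simps)
  finally have "A v \<bullet> w \<le> r * (norm v)\<^sup>2" by (simp add: nw)
  moreover have "A v \<bullet> w = norm v * norm (A v)"
    using False by (simp add: w_def flip: power2_norm_eq_inner) (simp add: power2_eq_square)
  ultimately show ?thesis using False by (simp add: power2_eq_square)
qed

section \<open>Geometric decay, and the convergence rate of heavy ball\<close>

lemma one_minus_power_le_exp:
  fixes q T :: real
  assumes "0 < q" "q \<le> 1" "1 \<le> T" "4 / q * (real j * ln T) \<le> real n"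
  shows "(1 - q / 4) ^ n \<le> 1 / T ^ j"
proof -
  have "(1 - q / 4) ^ n \<le> exp (- (q / 4)) ^ n"
    using assms exp_ge_add_one_self[of "- (q / 4)"] by (intro power_mono) auto
  also have "\<dots> = exp (- (q / 4 * real n))"
    by (simp add: exp_of_nat_mult[symmetric] mult.commute)
  also have "\<dots> \<le> exp (- (real j * ln T))"
  proof -
    have "q / 4 * (4 / q * (real j * ln T)) \<le> q / 4 * real n"
      using assms by (intro mult_left_mono) auto
    then show ?thesis using assms by simp
  qed
  also have "\<dots> = 1 / T ^ j"
    using assms by (simp add: exp_minus exp_of_nat_mult inverse_eq_divide)
  finally show ?thesis .
qed

text \<open>Bernoulli's inequality bounds the linear factor by a multiple of
  \<open>(1 + q / 2) ^ t\<close>, and \<open>(1 + q / 2) * (1 - q) \<le> 1 - q / 2\<close> absorbs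
  this growth at the price of half the rate.\<close>

lemma linear_times_geometric:
  fixes q :: real
  assumes "0 < q" "q \<le> 1"
  shows "real (Suc t) * (1 - q) ^ t \<le> 2 / q * (1 - q / 2) ^ t"
proof -
  have "real (Suc t) * (q / 2) \<le> 1 + real t * (q / 2)"
    using assms by (simp add: algebra_simps)
  also have "\<dots> \<le> (1 + q / 2) ^ t"
    using Bernoulli_inequality[of "q / 2" t] assms by simp
  finally have "real (Suc t) * (q / 2) * (1 - q) ^ t \<le> (1 + q / 2) ^ t * (1 - q) ^ t"
    using assms by (intro mult_right_mono) auto
  also have "\<dots> = ((1 + q / 2) * (1 - q)) ^ t"
    by (simp add: power_mult_distrib)
  also have "\<dots> \<le> (1 - q / 2) ^ t"
  proof (rule power_mono)
    have "(1 + q / 2) * (1 - q) = 1 - q / 2 - q\<^sup>2 / 2"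
      by (simp add: field_simps power2_eq_square)
    then show "(1 + q / 2) * (1 - q) \<le> 1 - q / 2" by simp
  qed (use assms in auto)
  finally show ?thesis using assms by (simp add: field_simps)
qed

text \<open>With \<open>r = (sqrt L - sqrt \<mu>) / (sqrt L + sqrt \<mu>)\<close> the step size
  gives \<open>sqrt (lam * \<mu>) = 1 - r\<close> and \<open>sqrt (lam * L) = 1 + r\<close>, so both
  candidates for \<open>\<theta>\<close> equal the square of \<open>r\<close>. The rate is weakened
  to the one of the Nesterov loop so that one iteration count serves both.\<close>

lemma heavy_ball_convergence:
  fixes H :: "'a::real_inner \<Rightarrow> 'a" and L \<mu> :: real
  assumes H: "linear H" "\<And>v w. H v \<bullet> w = v \<bullet> H w"
    and spec: "\<And>v. \<mu> * (norm v)\<^sup>2 \<le> v \<bullet> H v" "\<And>v. v \<bullet> H v \<le> L * (norm v)\<^sup>2"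
    and \<mu>: "0 < \<mu>" "\<mu> \<le> L"
    and lam: "lam = 4 / (sqrt L + sqrt \<mu>)\<^sup>2"
    and \<theta>: "\<theta> = max ((1 - sqrt (lam * \<mu>))\<^sup>2) ((1 - sqrt (lam * L))\<^sup>2)"
    and Q: "\<And>v. grad Q v = H v - H v'"
  shows "norm (heavy_ball Q lam \<theta> (Suc t) - v') \<le> 8 / sqrt (\<mu> / L) * (1 - sqrt (\<mu> / L) / 4) ^ t * norm v'"
proof -
  define q where "q = sqrt (\<mu> / L)"
  have L: "0 < L" using \<mu> by simp
  have q: "0 < q" "q \<le> 1" using \<mu> L by (simp_all add: q_def)
  define s r where "s = sqrt L + sqrt \<mu>" and "r = (sqrt L - sqrt \<mu>) / s"
  have s: "0 < s" using \<mu> L by (simp add: s_def add_pos_pos)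
  have sq_le: "sqrt \<mu> \<le> sqrt L" using \<mu> by simp
  have r0: "0 \<le> r" using sq_le s by (simp add: r_def)
  have lam_mu: "sqrt (lam * \<mu>) = 1 - r"
  proof -
    have "sqrt (lam * \<mu>) = 2 * sqrt \<mu> / s"
      using s unfolding lam s_def[symmetric] by (simp add: real_sqrt_mult real_sqrt_divide)
    also have "\<dots> = 1 - r" using s by (simp add: r_def field_simps) (simp add: s_def)
    finally show ?thesis .
  qed
  have lam_L: "sqrt (lam * L) = 1 + r"
  proof -
    have "sqrt (lam * L) = 2 * sqrt L / s"
      using s unfolding lam s_def[symmetric] by (simp add: real_sqrt_mult real_sqrt_divide)
    also have "\<dots> = 1 + r" using s by (simp add: r_def field_simps) (simp add: s_def)
    finally show ?thesis .
  qed
  have \<theta>_eq: "\<theta> = r\<^sup>2" unfolding \<theta> lam_mu lam_L by simp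
  have lam_pos: "0 < lam" using s by (simp add: lam s_def)
  have lam_mu': "lam * \<mu> = (1 - r)\<^sup>2" and lam_L': "lam * L = (1 + r)\<^sup>2"
    using lam_pos \<mu> L by (simp_all flip: lam_mu lam_L)
  have r_le: "r \<le> 1 - q"
  proof -
    have "r \<le> (sqrt L - sqrt \<mu>) / sqrt L"
      unfolding r_def using sq_le L \<mu> by (intro divide_left_mono) (auto simp: s_def intro!: mult_pos_pos add_pos_pos)
    also have "\<dots> = 1 - q" using L by (simp add: q_def real_sqrt_divide diff_divide_distrib)
    finally show ?thesis .
  qed
  interpret H: linear H by fact
  \<comment> \<open>Half the coefficient of the latest error in the heavy-ball recursion. The bounds
    on \<open>H\<close> confine its quadratic form to the interval from \<open>-r\<close> to
    \<open>r\<close> times the squared norm.\<close>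
  define A where "A v = (1 / 2) *\<^sub>R ((1 + r\<^sup>2) *\<^sub>R v - lam *\<^sub>R H v)" for v
  have A: "linear A" "A v \<bullet> w = v \<bullet> A w" for v w
  proof -
    show "linear A"
      by (rule linearI) (simp_all add: A_def H.add H.scaleR scaleR_add_right scaleR_diff_right mult.commute)
    show "A v \<bullet> w = v \<bullet> A w"
      by (simp add: A_def inner_diff_left inner_diff_right H(2))
  qed
  have "\<bar>v \<bullet> A v\<bar> \<le> r * (norm v)\<^sup>2" for v
  proof -
    have vA: "2 * (v \<bullet> A v) = (1 + r\<^sup>2) * (norm v)\<^sup>2 - lam * (v \<bullet> H v)"
      by (simp add: A_def inner_simps power2_norm_eq_inner)
    have "lam * (\<mu> * (norm v)\<^sup>2) \<le> lam * (v \<bullet> H v)" "lam * (v \<bullet> H v) \<le> lam * (L * (norm v)\<^sup>2)"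
      using spec lam_pos by (auto intro!: mult_left_mono)
    then have "(1 - r)\<^sup>2 * (norm v)\<^sup>2 \<le> lam * (v \<bullet> H v)" "lam * (v \<bullet> H v) \<le> (1 + r)\<^sup>2 * (norm v)\<^sup>2"
      unfolding lam_mu'[symmetric] lam_L'[symmetric] by (simp_all add: mult.assoc)
    moreover have "(1 - r)\<^sup>2 * (norm v)\<^sup>2 = (1 + r\<^sup>2) * (norm v)\<^sup>2 - 2 * (r * (norm v)\<^sup>2)"
      "(1 + r)\<^sup>2 * (norm v)\<^sup>2 = (1 + r\<^sup>2) * (norm v)\<^sup>2 + 2 * (r * (norm v)\<^sup>2)"
      by (simp_all add: power2_eq_square algebra_simps)
    ultimately show ?thesis using vA by linarith
  qed
  then have A_norm: "norm (A v) \<le> r * norm v" for v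
    using symmetric_form_bound[OF A] by blast
  define u where "u t = heavy_ball Q lam \<theta> t - v'" for t
  have rec: "u (Suc (Suc t)) = 2 *\<^sub>R A (u (Suc t)) - r\<^sup>2 *\<^sub>R u t" for t
    by (simp add: u_def A_def Q \<theta>_eq H.diff algebra_simps)
  have "norm (u (Suc t)) \<le> (r ^ Suc t + 3 * real (Suc t) * r ^ t) * norm (- v')"
    using q r0 r_le A A_norm rec
    by (intro heavy_ball_recursion[where A = A and r = r and u = u and a = "- v'"]) (auto simp: u_def)
  also have "\<dots> \<le> 8 / q * (1 - q / 4) ^ t * norm (- v')"
  proof (rule mult_right_mono)
    have "r ^ Suc t \<le> 1 * r ^ t"
      unfolding power_Suc using r0 r_le q by (intro mult_right_mono) auto
    also have "\<dots> \<le> real (Suc t) * r ^ t"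
      using r0 by (intro mult_right_mono) auto
    finally have "r ^ Suc t + 3 * real (Suc t) * r ^ t \<le> 4 * (real (Suc t) * r ^ t)"
      unfolding mult.assoc by linarith
    also have "\<dots> \<le> 4 * (real (Suc t) * (1 - q) ^ t)"
      using r0 r_le by (intro mult_left_mono power_mono) auto
    also have "\<dots> \<le> 4 * (2 / q * (1 - q / 2) ^ t)"
      using linear_times_geometric[OF q] by (intro mult_left_mono) auto
    also have "\<dots> \<le> 4 * (2 / q * (1 - q / 4) ^ t)"
      using q by (intro mult_left_mono power_mono) auto
    finally show "r ^ Suc t + 3 * real (Suc t) * r ^ t \<le> 8 / q * (1 - q / 4) ^ t" by simp
  qed simp
  finally show ?thesis by (simp add: u_def q_def)
qed

section \<open>Convex and smooth functions\<close>

lemma grad_eqI: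
  assumes "GDERIV F x :> D"
  shows "grad F x = D"
proof -
  have "E = D" if "GDERIV F x :> E" for E
  proof -
    have "(\<lambda>h. h \<bullet> E) = (\<lambda>h. h \<bullet> D)"
      using that assms unfolding gderiv_def by (rule has_derivative_unique)
    then have "(E - D) \<bullet> E = (E - D) \<bullet> D" by (rule fun_cong)
    then have "(E - D) \<bullet> (E - D) = 0" by (simp add: inner_diff_right)
    then show ?thesis by simp
  qed
  then show ?thesis
    unfolding grad_def by (rule the_equality[where P = "\<lambda>D. GDERIV F x :> D", OF assms])
qed

text \<open>Riesz representation: the gradient is the adjoint of the derivative applied to
  1.\<close>

lemma GDERIV_grad:
  fixes F :: "'a::euclidean_space \<Rightarrow> real"
  assumes "F differentiable at x"
  shows "GDERIV F x :> grad F x"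
proof -
  obtain F' where F': "(F has_derivative F') (at x)"
    using assms by (auto simp: differentiable_def)
  then have "linear F'" by (rule has_derivative_linear)
  then have "F' h = h \<bullet> adjoint F' 1" for h
    by (simp add: adjoint_works)
  then have "F' = (\<lambda>h. h \<bullet> adjoint F' 1)" by blast
  with F' have "GDERIV F x :> adjoint F' 1"
    unfolding gderiv_def by simp
  then show ?thesis by (simp add: grad_eqI)
qed

text \<open>Reduction to one variable: along the line through \<open>v\<close> and \<open>u\<close>
  the tangent inequality for real convex functions applies.\<close>

lemma convex_on_gradient:
  fixes F :: "'a::real_inner \<Rightarrow> real"
  assumes "convex_on UNIV F" "GDERIV F v :> D"
  shows "F v + D \<bullet> (u - v) \<le> F u"
proof -
  define \<phi> where "\<phi> t = F (v + t *\<^sub>R (u - v))" for t :: real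
  have "convex_on UNIV \<phi>"
  proof (rule convex_onI)
    fix t x y :: real assume t: "0 < t" "t < 1"
    have "v + ((1 - t) *\<^sub>R x + t *\<^sub>R y) *\<^sub>R (u - v) = (1 - t) *\<^sub>R (v + x *\<^sub>R (u - v)) + t *\<^sub>R (v + y *\<^sub>R (u - v))"
      by (simp add: algebra_simps)
    then show "\<phi> ((1 - t) *\<^sub>R x + t *\<^sub>R y) \<le> (1 - t) * \<phi> x + t * \<phi> y"
      unfolding \<phi>_def using convex_onD[OF assms(1), of t] t by simp
  qed simp
  moreover have "(\<phi> has_field_derivative D \<bullet> (u - v)) (at 0)"
  proof -
    have "(F has_derivative (\<lambda>h. h \<bullet> D)) (at (v + 0 *\<^sub>R (u - v)))"
      using assms(2) by (simp add: gderiv_def)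
    then have "((\<lambda>t. F (v + t *\<^sub>R (u - v))) has_derivative (\<lambda>t. (t *\<^sub>R (u - v)) \<bullet> D)) (at 0)"
      by (rule has_derivative_compose[rotated]) (auto intro!: derivative_eq_intros)
    then show ?thesis
      unfolding has_field_derivative_def \<phi>_def
      by (rule has_derivative_eq_rhs) (auto simp: inner_commute mult.commute)
  qed
  ultimately have "\<phi> 1 - \<phi> 0 \<ge> (D \<bullet> (u - v)) * (1 - 0)"
    by (intro convex_on_imp_above_tangent[of UNIV]) auto
  then show ?thesis by (simp add: \<phi>_def)
qed

lemma descent_inequality:
  fixes F :: "'a::real_inner \<Rightarrow> real"
  assumes deriv: "\<And>x. GDERIV F x :> dF x" and lip: "L-lipschitz_on UNIV dF"
  shows "F u \<le> F v + dF v \<bullet> (u - v) + L / 2 * (norm (u - v))\<^sup>2"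
proof -
  define d where "d = u - v"
  \<comment> \<open>The value along the segment minus the claimed bound. The Lipschitz condition
    makes its derivative nonpositive, so monotonicity replaces integration of the gradient.\<close>
  define \<phi> where "\<phi> t = F (v + t *\<^sub>R d) - t * (dF v \<bullet> d) - L / 2 * t\<^sup>2 * (norm d)\<^sup>2" for t :: real
  have "\<phi> 1 \<le> \<phi> 0"
  proof (rule DERIV_nonpos_imp_nonincreasing[of 0 1 \<phi>])
    fix t :: real assume t: "0 \<le> t" "t \<le> 1"
    have "(F has_derivative (\<lambda>h. h \<bullet> dF (v + t *\<^sub>R d))) (at (v + t *\<^sub>R d))"
      using deriv by (simp add: gderiv_def)
    then have "((\<lambda>t. F (v + t *\<^sub>R d)) has_derivative (\<lambda>s. (s *\<^sub>R d) \<bullet> dF (v + t *\<^sub>R d))) (at t)"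
      by (rule has_derivative_compose[rotated]) (auto intro!: derivative_eq_intros)
    then have "((\<lambda>t. F (v + t *\<^sub>R d)) has_field_derivative (d \<bullet> dF (v + t *\<^sub>R d))) (at t)"
      unfolding has_field_derivative_def by (rule has_derivative_eq_rhs) (auto simp: mult.commute)
    then have "(\<phi> has_field_derivative (d \<bullet> dF (v + t *\<^sub>R d) - dF v \<bullet> d - L * t * (norm d)\<^sup>2)) (at t)"
      unfolding \<phi>_def by (auto intro!: derivative_eq_intros)
    moreover have "d \<bullet> dF (v + t *\<^sub>R d) - dF v \<bullet> d - L * t * (norm d)\<^sup>2 \<le> 0"
    proof -
      have "norm (dF (v + t *\<^sub>R d) - dF v) \<le> L * norm (t *\<^sub>R d)"
        using lipschitz_onD[OF lip, of "v + t *\<^sub>R d" v] by (simp add: dist_norm)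
      then have "norm d * norm (dF (v + t *\<^sub>R d) - dF v) \<le> norm d * (L * (t * norm d))"
        using t by (intro mult_left_mono) auto
      then have "d \<bullet> (dF (v + t *\<^sub>R d) - dF v) \<le> norm d * (L * (t * norm d))"
        using norm_cauchy_schwarz[of d "dF (v + t *\<^sub>R d) - dF v"] by linarith
      moreover have "norm d * (L * (t * norm d)) = L * t * (norm d)\<^sup>2"
        by (simp add: power2_eq_square)
      ultimately show ?thesis
        using inner_commute[of d "dF v"] by (simp add: inner_diff_right)
    qed
    ultimately show "\<exists>y. DERIV \<phi> t :> y \<and> y \<le> 0" by blast
  qed simp
  then show ?thesis by (simp add: \<phi>_def d_def)
qed

lemma GDERIV_sq_norm: "GDERIV (\<lambda>u. \<epsilon> / (2 * R) * (norm u)\<^sup>2) x :> (\<epsilon> / R) *\<^sub>R x"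
  for x :: "'a::real_inner"
proof -
  define a where "a = \<epsilon> / (2 * R)"
  have "((\<lambda>u. a * (u \<bullet> u)) has_derivative (\<lambda>k. a * (x \<bullet> k + k \<bullet> x))) (at x)"
    by (auto intro!: derivative_eq_intros)
  moreover have "a * (x \<bullet> k + k \<bullet> x) = k \<bullet> (\<epsilon> / R) *\<^sub>R x" for k
    by (simp add: a_def inner_commute[of k])
  ultimately show ?thesis
    unfolding gderiv_def power2_norm_eq_inner a_def[symmetric] by simp
qed

section \<open>Bilevel problems with a quadratic lower level\<close>

text \<open>The algorithm is stated with condition numbers, the convergence analysis with their
  inverse square roots; these identities translate the momentum weights.\<close>

lemma momentum_coefficients:
  fixes \<mu> L :: real
  assumes "0 < \<mu>" "0 < L"
  shows "(sqrt (L / \<mu>) - 1) / (sqrt (L / \<mu>) + 1) = (1 - sqrt (\<mu> / L)) / (1 + sqrt (\<mu> / L))"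
    and "2 * sqrt (L / \<mu>) / (sqrt (L / \<mu>) + 1) = 1 + (1 - sqrt (\<mu> / L)) / (1 + sqrt (\<mu> / L))"
proof -
  define q where "q = sqrt (\<mu> / L)"
  have q: "sqrt (L / \<mu>) = 1 / q" "0 < q"
    using assms by (simp_all add: q_def real_sqrt_divide)
  show "(sqrt (L / \<mu>) - 1) / (sqrt (L / \<mu>) + 1) = (1 - sqrt (\<mu> / L)) / (1 + sqrt (\<mu> / L))"
    "2 * sqrt (L / \<mu>) / (sqrt (L / \<mu>) + 1) = 1 + (1 - sqrt (\<mu> / L)) / (1 + sqrt (\<mu> / L))"
    unfolding q_def[symmetric] q(1) using q(2) by (simp_all add: divide_simps)
qed

locale quadratic_bilevel =
  fixes f g :: "real^'p \<Rightarrow> real^'q \<Rightarrow> real"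
    and H :: "real^'q^'q" and J :: "real^'q^'p" and b :: "real^'q" and h :: "real^'p \<Rightarrow> real"
    and L_x L_xy L_y Lt_xy Lt_y \<mu> B :: real
  assumes cls: "(f, g) \<in> F_csc L_x L_xy L_y Lt_xy Lt_y \<mu> B"
    and quadratic: "\<And>x y. g x y = 1 / 2 * (y \<bullet> (H *v y)) + x \<bullet> (J *v y) + b \<bullet> y + h x"
    and H_sym: "transpose H = H" and H_le: "H \<preceq> mat Lt_y"
    and J_le: "onorm ((*v) J) \<le> Lt_xy"
begin

section \<open>Constants, and bounds on the matrices H and J\<close>

lemma f_differentiable: "(\<lambda>(x, y). f x y) differentiable (at z)"
  and lip_xx: "L_x-lipschitz_on UNIV (\<lambda>x. grad_x f x y)"
  and lip_xy: "L_xy-lipschitz_on UNIV (\<lambda>y. grad_x f x y)"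
  and lip_yx: "L_xy-lipschitz_on UNIV (\<lambda>x. grad_y f x y)"
  and lip_yy: "L_y-lipschitz_on UNIV (\<lambda>y. grad_y f x y)"
  and lip_g: "Lt_xy-lipschitz_on UNIV (\<lambda>x. grad_y g x y)"
  and convex_Phi: "convex_on UNIV (Phi f g)"
  and g_strongly_convex: "strongly_convex \<mu> (g x)"
  and B_pos: "0 < B"
  using cls unfolding F_csc_def mem_Collect_eq prod.case by blast+

lemma constants_nonneg: "0 \<le> L_x" "0 \<le> L_xy" "0 \<le> L_y" "0 \<le> Lt_xy"
  using lipschitz_on_nonneg[OF lip_xx] lipschitz_on_nonneg[OF lip_xy]
    lipschitz_on_nonneg[OF lip_yy] lipschitz_on_nonneg[OF lip_g] by simp_all

lemma \<mu>_pos: "0 < \<mu>"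
  using g_strongly_convex by (simp add: strongly_convex_def)

lemma H_inner: "(H *v u) \<bullet> w = u \<bullet> (H *v w)"
  by (metis H_sym dot_lmul_matrix transpose_matrix_vector)

lemma J_inner: "x \<bullet> (J *v y) = (x v* J) \<bullet> y"
  by (rule dot_lmul_matrix[symmetric])

text \<open>Midpoint convexity is tested at \<open>v\<close> and \<open>-v\<close>, where the linear
  part of \<open>g 0\<close> cancels and only the quadratic form remains.\<close>

lemma H_lower: "\<mu> * (norm v)\<^sup>2 \<le> v \<bullet> (H *v v)"
proof -
  define \<phi> where "\<phi> y = g 0 y - \<mu> / 2 * (norm y)\<^sup>2" for y
  have "convex_on UNIV \<phi>"
    using g_strongly_convex[of 0] unfolding strongly_convex_def \<phi>_def by blast
  then have "\<phi> ((1 - 1 / 2) *\<^sub>R v + (1 / 2) *\<^sub>R (- v)) \<le> (1 - 1 / 2) * \<phi> v + 1 / 2 * \<phi> (- v)"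
    by (rule convex_onD) auto
  moreover have "(1 - 1 / 2) *\<^sub>R v + (1 / 2) *\<^sub>R (- v) = 0" by simp
  moreover have "H *v (- v) = - (H *v v)"
    using matrix_vector_mult_diff_distrib[of H 0 v] by simp
  ultimately show ?thesis
    by (simp add: \<phi>_def quadratic field_simps)
qed

lemma H_upper: "v \<bullet> (H *v v) \<le> Lt_y * (norm v)\<^sup>2"
proof -
  have "mat Lt_y *v v = Lt_y *\<^sub>R v"
    by (simp add: vec_eq_iff matrix_vector_mult_def mat_def if_distrib[of "\<lambda>c. c * _"] cong: if_cong)
  moreover have "v \<bullet> (H *v v) \<le> v \<bullet> (mat Lt_y *v v)"
    using H_le unfolding loewner_le_def by blast
  ultimately show ?thesis
    by (simp add: power2_norm_eq_inner)
qed

lemma \<mu>_le: "\<mu> \<le> Lt_y"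
  using order_trans[OF H_lower H_upper, of "axis undefined 1"] by (simp add: norm_axis_1)

lemma Lt_y_pos: "0 < Lt_y"
  using \<mu>_pos \<mu>_le by simp

definition Hi :: "real^'q^'q" where "Hi = matrix_inv H"

lemma H_Hi [simp]: "H *v (Hi *v v) = v"
proof -
  have "x = 0" if "H *v x = 0" for x
    using H_lower[of x] \<mu>_pos that by (simp add: mult_le_0_iff)
  then have "invertible H"
    by (simp add: invertible_left_inverse matrix_left_invertible_ker)
  then have "H ** Hi = mat 1"
    unfolding Hi_def matrix_inv_def invertible_def by (rule someI2_ex) simp
  then show ?thesis
    by (simp add: matrix_vector_mul_assoc)
qed

lemma Hi_inner: "(Hi *v u) \<bullet> w = u \<bullet> (Hi *v w)"
  using H_inner[of "Hi *v u" "Hi *v w"] by simp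

lemma norm_Hi: "norm (Hi *v v) \<le> norm v / \<mu>"
proof (cases "Hi *v v = 0")
  case False
  have "\<mu> * (norm (Hi *v v))\<^sup>2 \<le> (Hi *v v) \<bullet> v"
    using H_lower[of "Hi *v v"] by simp
  also have "\<dots> \<le> norm (Hi *v v) * norm v"
    by (rule norm_cauchy_schwarz)
  finally have "norm (Hi *v v) * (\<mu> * norm (Hi *v v)) \<le> norm (Hi *v v) * norm v"
    by (simp add: power2_eq_square algebra_simps)
  then have "\<mu> * norm (Hi *v v) \<le> norm v"
    using False by simp
  then show ?thesis using \<mu>_pos by (simp add: field_simps)
qed (use \<mu>_pos in simp)

lemma norm_J: "norm (J *v v) \<le> Lt_xy * norm v"
  using onorm[OF matrix_vector_mul_bounded_linear, of J v] mult_right_mono[OF J_le norm_ge_zero[of v]]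
  by linarith

text \<open>A matrix and its transpose have the same operator norm: pair \<open>x v* J\<close> with
  itself and move \<open>J\<close> to the other side.\<close>

lemma norm_Jt: "norm (x v* J) \<le> Lt_xy * norm x"
proof (cases "x v* J = 0")
  case False
  have "(norm (x v* J))\<^sup>2 = x \<bullet> (J *v (x v* J))"
    by (simp add: J_inner power2_norm_eq_inner)
  also have "\<dots> \<le> norm x * norm (J *v (x v* J))"
    by (rule norm_cauchy_schwarz)
  also have "\<dots> \<le> norm x * (Lt_xy * norm (x v* J))"
    by (intro mult_left_mono norm_J) simp
  finally have "norm (x v* J) * norm (x v* J) \<le> norm (x v* J) * (Lt_xy * norm x)"
    by (simp add: power2_eq_square algebra_simps)
  then show ?thesis using False by simp
qed (use constants_nonneg in simp)

lemma bounded_linear_Jt: "bounded_linear (\<lambda>x. x v* J)"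
proof -
  have "(\<lambda>x. x v* J) = (*v) (transpose J)" by (simp add: fun_eq_iff)
  then show ?thesis by simp
qed

lemma Jt_diff: "(x - x') v* J = x v* J - x' v* J"
  by (rule linear_diff[OF bounded_linear.linear[OF bounded_linear_Jt]])

lemma H_diff: "A *v (u - v) = A *v u - A *v v" for A :: "real^'n^'m"
  by (rule matrix_vector_mult_diff_distrib)

section \<open>Closed forms of the lower-level solution and of the hypergradient\<close>

definition dg :: "real^'p \<Rightarrow> real^'q \<Rightarrow> real^'q" where
  "dg x y = H *v y + x v* J + b"

text \<open>The zero of \<open>dg x\<close>, hence the lower-level minimizer; it is affine in
  \<open>x\<close>.\<close>

definition ys :: "real^'p \<Rightarrow> real^'q" where
  "ys x = - (Hi *v (x v* J + b))"

text \<open>The hypergradient obtained by implicit differentiation: \<open>ys\<close> responds to a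
  change \<open>k\<close> of \<open>x\<close> by \<open>- (Hi *v (k v* J))\<close>.\<close>

definition dPhi :: "real^'p \<Rightarrow> real^'p" where
  "dPhi x = grad_x f x (ys x) - J *v (Hi *v grad_y f x (ys x))"

lemma g_expansion: "g x u = g x v + dg x v \<bullet> (u - v) + 1 / 2 * ((u - v) \<bullet> (H *v (u - v)))"
  using H_inner[of v u] inner_commute[of u "H *v v"] inner_commute[of v "H *v v"]
  by (simp add: quadratic dg_def H_diff inner_diff_left inner_diff_right inner_add_left J_inner field_simps)

lemma GDERIV_g: "GDERIV (g x) y :> dg x y"
proof -
  have lin: "((\<lambda>y. A *v y) has_derivative (\<lambda>k. A *v k)) (at y)" for A :: "real^'q^'m"
    by (rule bounded_linear_imp_has_derivative) simp
  have "((\<lambda>y. 1 / 2 * (y \<bullet> (H *v y)) + x \<bullet> (J *v y) + b \<bullet> y + h x) has_derivative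
      (\<lambda>k. 1 / 2 * (y \<bullet> (H *v k) + k \<bullet> (H *v y)) + x \<bullet> (J *v k) + b \<bullet> k)) (at y)"
    by (auto intro!: derivative_eq_intros lin)
  moreover have "1 / 2 * (y \<bullet> (H *v k) + k \<bullet> (H *v y)) + x \<bullet> (J *v k) + b \<bullet> k = k \<bullet> dg x y" for k
    using H_inner[of y k] inner_commute[of k "H *v y"]
    by (simp add: dg_def inner_add_right J_inner inner_commute[of k])
  ultimately show ?thesis
    unfolding gderiv_def quadratic[abs_def] by simp
qed

lemma grad_y_g: "grad_y g x y = dg x y"
  unfolding grad_y_def by (rule grad_eqI) (rule GDERIV_g)

lemma hess_yy_g: "hess_yy g x y = H"
proof -
  have "((\<lambda>y. H *v y) has_derivative (\<lambda>k. H *v k)) (at y)"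
    by (rule bounded_linear_imp_has_derivative) simp
  then have "((\<lambda>w. dg x w) has_derivative (\<lambda>k. H *v k)) (at y)"
    unfolding dg_def by (auto intro!: derivative_eq_intros)
  then show ?thesis
    unfolding hess_yy_def jacobian_def grad_y_g by (simp flip: frechet_derivative_at)
qed

lemma hess_xy_g: "hess_xy g x y = J"
proof -
  have "((\<lambda>u. u v* J) has_derivative (\<lambda>k. k v* J)) (at x)"
    by (rule bounded_linear_imp_has_derivative) (rule bounded_linear_Jt)
  then have "((\<lambda>u. dg u y) has_derivative (\<lambda>k. k v* J)) (at x)"
    unfolding dg_def by (auto intro!: derivative_eq_intros)
  then have "jacobian (\<lambda>u. dg u y) (at x) = matrix (\<lambda>k. transpose J *v k)"
    unfolding jacobian_def by (simp flip: frechet_derivative_at)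
  then show ?thesis
    unfolding hess_xy_def grad_y_g matrix_of_matrix_vector_mul by simp
qed

lemma dg_ys: "dg x (ys x) = 0"
proof -
  have "H *v (- w) = - (H *v w)" for w
    using H_diff[of H 0 w] by simp
  then show ?thesis by (simp add: dg_def ys_def)
qed

lemma nesterov_inner: "nesterov_objective (g x) (dg x) Lt_y \<mu> (sqrt (\<mu> / Lt_y)) (ys x)"
proof
  show "g x v + dg x v \<bullet> (u - v) + \<mu> / 2 * (norm (u - v))\<^sup>2 \<le> g x u" for u v
    using g_expansion[of x u v] H_lower[of "u - v"] by simp
  show "g x u \<le> g x v + dg x v \<bullet> (u - v) + Lt_y / 2 * (norm (u - v))\<^sup>2" for u v
    using g_expansion[of x u v] H_upper[of "u - v"] by simp
  show "g x (ys x) \<le> g x u" for u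
  proof -
    have "0 \<le> \<mu> * (norm (u - ys x))\<^sup>2" using \<mu>_pos by simp
    then show ?thesis
      using g_expansion[of x u "ys x"] H_lower[of "u - ys x"] by (simp add: dg_ys)
  qed
qed (use \<mu>_pos \<mu>_le in auto)

text \<open>\<open>y_star\<close> is a choice among minimizers, so its value is determined only
  after uniqueness, which quadratic growth provides.\<close>

lemma y_star_g: "y_star g x = ys x"
proof -
  interpret nesterov_objective "g x" "dg x" Lt_y \<mu> "sqrt (\<mu> / Lt_y)" "ys x"
    by (rule nesterov_inner)
  have "is_arg_min (g x) (\<lambda>_. True) (ys x)"
    using minimal by (simp add: is_arg_min_def not_less)
  moreover have "y = ys x" if "is_arg_min (g x) (\<lambda>_. True) y" for y
  proof -
    have "g x y \<le> g x (ys x)" using that by (simp add: is_arg_min_def not_less)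
    then have "\<mu> / 2 * (norm (y - ys x))\<^sup>2 \<le> 0" using quadratic_growth[of y] by simp
    then show ?thesis using \<mu>_pos by (simp add: mult_le_0_iff)
  qed
  ultimately show ?thesis
    unfolding y_star_def arg_min_def by (rule some_equality)
qed

lemma Phi_eq: "Phi f g x = f x (ys x)"
  by (simp add: Phi_def y_star_g)

lemma ys_lipschitz: "norm (ys x - ys x') \<le> Lt_xy / \<mu> * norm (x - x')"
proof -
  have "ys x - ys x' = Hi *v ((x' - x) v* J)"
    by (simp add: ys_def Jt_diff H_diff matrix_vector_right_distrib)
  then have "norm (ys x - ys x') \<le> norm ((x' - x) v* J) / \<mu>"
    by (simp add: norm_Hi)
  also have "\<dots> \<le> (Lt_xy * norm (x' - x)) / \<mu>"
    using \<mu>_pos by (intro divide_right_mono norm_Jt) auto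
  finally show ?thesis by (simp add: norm_minus_commute)
qed

lemma GDERIV_f:
  "GDERIV (\<lambda>u. f u y) x :> grad_x f x y" "GDERIV (\<lambda>w. f x w) y :> grad_y f x y"
proof -
  obtain F' where F': "((\<lambda>(x, y). f x y) has_derivative F') (at (x, y))"
    using f_differentiable by (auto simp: differentiable_def)
  have "((\<lambda>u. (u, y)) has_derivative (\<lambda>k. (k, 0))) (at x)"
    by (auto intro!: derivative_eq_intros)
  from has_derivative_compose[OF this, of "\<lambda>(x, y). f x y" F'] F'
  have "((\<lambda>u. f u y) has_derivative (\<lambda>k. F' (k, 0))) (at x)" by simp
  then show "GDERIV (\<lambda>u. f u y) x :> grad_x f x y"
    unfolding grad_x_def by (intro GDERIV_grad) (auto simp: differentiable_def)
  have "((\<lambda>w. (x, w)) has_derivative (\<lambda>k. (0, k))) (at y)"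
    by (auto intro!: derivative_eq_intros)
  from has_derivative_compose[OF this, of "\<lambda>(x, y). f x y" F'] F'
  have "((\<lambda>w. f x w) has_derivative (\<lambda>k. F' (0, k))) (at y)" by simp
  then show "GDERIV (\<lambda>w. f x w) y :> grad_y f x y"
    unfolding grad_y_def by (intro GDERIV_grad) (auto simp: differentiable_def)
qed

text \<open>The joint derivative of \<open>f\<close> is identified on each coordinate subspace with
  a partial gradient, by uniqueness of derivatives; the chain rule along
  \<open>u \<mapsto> (u, ys u)\<close> and the symmetry of \<open>Hi\<close> then yield
  \<open>dPhi\<close>.\<close>

lemma GDERIV_Phi: "GDERIV (Phi f g) x :> dPhi x"
proof -
  obtain F' where F': "((\<lambda>(x, y). f x y) has_derivative F') (at (x, ys x))"
    using f_differentiable by (auto simp: differentiable_def)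
  interpret F': linear F' using F' by (rule has_derivative_linear)
  have "((\<lambda>u. (u, ys x)) has_derivative (\<lambda>k. (k, 0))) (at x)"
    by (auto intro!: derivative_eq_intros)
  from has_derivative_compose[OF this, of "\<lambda>(x, y). f x y" F'] F'
  have "((\<lambda>u. f u (ys x)) has_derivative (\<lambda>k. F' (k, 0))) (at x)" by simp
  then have Fx: "(\<lambda>k. F' (k, 0)) = (\<lambda>k. k \<bullet> grad_x f x (ys x))"
    using GDERIV_f(1) unfolding gderiv_def by (rule has_derivative_unique)
  have "((\<lambda>w. (x, w)) has_derivative (\<lambda>k. (0, k))) (at (ys x))"
    by (auto intro!: derivative_eq_intros)
  from has_derivative_compose[OF this, of "\<lambda>(x, y). f x y" F'] F'
  have "((\<lambda>w. f x w) has_derivative (\<lambda>k. F' (0, k))) (at (ys x))" by simp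
  then have Fy: "(\<lambda>k. F' (0, k)) = (\<lambda>k. k \<bullet> grad_y f x (ys x))"
    using GDERIV_f(2) unfolding gderiv_def by (rule has_derivative_unique)
  have "((\<lambda>u. u v* J) has_derivative (\<lambda>k. k v* J)) (at x)"
    by (rule bounded_linear_imp_has_derivative) (rule bounded_linear_Jt)
  then have "((\<lambda>u. u v* J + b) has_derivative (\<lambda>k. k v* J)) (at x)"
    by (auto intro!: derivative_eq_intros)
  then have "((\<lambda>u. Hi *v (u v* J + b)) has_derivative (\<lambda>k. Hi *v (k v* J))) (at x)"
    by (rule bounded_linear.has_derivative[OF matrix_vector_mul_bounded_linear])
  then have "(ys has_derivative (\<lambda>k. - (Hi *v (k v* J)))) (at x)"
    unfolding ys_def[abs_def] by (rule has_derivative_minus)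
  then have "((\<lambda>u. (u, ys u)) has_derivative (\<lambda>k. (k, - (Hi *v (k v* J))))) (at x)"
    by (intro has_derivative_Pair) (auto intro: has_derivative_ident)
  from has_derivative_compose[OF this F']
  have "((\<lambda>u. f u (ys u)) has_derivative (\<lambda>k. F' (k, - (Hi *v (k v* J))))) (at x)" by simp
  moreover have "F' (k, - (Hi *v (k v* J))) = k \<bullet> dPhi x" for k
  proof -
    have "F' (k, - (Hi *v (k v* J))) = F' (k, 0) + F' (0, - (Hi *v (k v* J)))"
      by (simp flip: F'.add)
    also have "\<dots> = k \<bullet> grad_x f x (ys x) - (Hi *v (k v* J)) \<bullet> grad_y f x (ys x)"
      using fun_cong[OF Fx, of k] fun_cong[OF Fy, of "- (Hi *v (k v* J))"] by simp
    also have "\<dots> = k \<bullet> dPhi x"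
      by (simp add: dPhi_def inner_diff_right Hi_inner J_inner)
    finally show ?thesis .
  qed
  ultimately show ?thesis
    unfolding gderiv_def Phi_eq[abs_def] by simp
qed

section \<open>Smoothness of the hyperobjective and accuracy of the hypergradient estimate\<close>

lemma grad_x_diff: "norm (grad_x f x y - grad_x f x' y') \<le> L_x * norm (x - x') + L_xy * norm (y - y')"
  using lipschitz_onD[OF lip_xx, of x x' y] lipschitz_onD[OF lip_xy, of y y' x']
    norm_triangle_ineq[of "grad_x f x y - grad_x f x' y" "grad_x f x' y - grad_x f x' y'"]
  by (simp add: dist_norm)

lemma grad_y_diff: "norm (grad_y f x y - grad_y f x' y') \<le> L_xy * norm (x - x') + L_y * norm (y - y')"
  using lipschitz_onD[OF lip_yx, of x x' y] lipschitz_onD[OF lip_yy, of y y' x']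
    norm_triangle_ineq[of "grad_y f x y - grad_y f x' y" "grad_y f x' y - grad_y f x' y'"]
  by (simp add: dist_norm)

lemma norm_J_Hi: "norm (J *v (Hi *v v)) \<le> Lt_xy / \<mu> * norm v"
  using norm_J[of "Hi *v v"] mult_left_mono[OF norm_Hi[of v] constants_nonneg(4)] by simp

text \<open>The Lipschitz constant that the triangle inequality gives for \<open>dPhi\<close>. The
  last term has order \<open>1 / \<mu>^2\<close> because both \<open>ys\<close> and
  \<open>Hi\<close> contribute a factor \<open>1 / \<mu>\<close>.\<close>

definition L_Phi :: real where
  "L_Phi = L_x + 2 * L_xy * Lt_xy / \<mu> + L_y * Lt_xy\<^sup>2 / \<mu>\<^sup>2"

lemma dPhi_lipschitz: "norm (dPhi x - dPhi x') \<le> L_Phi * norm (x - x')"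
proof -
  define n where "n = norm (x - x')"
  define dy where "dy = grad_y f x (ys x) - grad_y f x' (ys x')"
  have "dPhi x - dPhi x' = (grad_x f x (ys x) - grad_x f x' (ys x')) - J *v (Hi *v dy)"
    by (simp add: dPhi_def dy_def H_diff)
  then have "norm (dPhi x - dPhi x') \<le> norm (grad_x f x (ys x) - grad_x f x' (ys x')) + norm (J *v (Hi *v dy))"
    by (simp add: norm_triangle_ineq4)
  also have "\<dots> \<le> (L_x * n + L_xy * (Lt_xy / \<mu> * n)) + Lt_xy / \<mu> * (L_xy * n + L_y * (Lt_xy / \<mu> * n))"
  proof (rule add_mono)
    show "norm (grad_x f x (ys x) - grad_x f x' (ys x')) \<le> L_x * n + L_xy * (Lt_xy / \<mu> * n)"
      using grad_x_diff[of x "ys x" x' "ys x'"] mult_left_mono[OF ys_lipschitz[of x x'] constants_nonneg(2)]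
      by (simp add: n_def)
    have "norm dy \<le> L_xy * n + L_y * (Lt_xy / \<mu> * n)"
      using grad_y_diff[of x "ys x" x' "ys x'"] mult_left_mono[OF ys_lipschitz[of x x'] constants_nonneg(3)]
      by (simp add: n_def dy_def)
    then have "Lt_xy / \<mu> * norm dy \<le> Lt_xy / \<mu> * (L_xy * n + L_y * (Lt_xy / \<mu> * n))"
      using constants_nonneg \<mu>_pos by (intro mult_left_mono) auto
    then show "norm (J *v (Hi *v dy)) \<le> Lt_xy / \<mu> * (L_xy * n + L_y * (Lt_xy / \<mu> * n))"
      using norm_J_Hi[of dy] by linarith
  qed
  also have "\<dots> = L_Phi * n"
    using \<mu>_pos by (simp add: L_Phi_def field_simps power2_eq_square)
  finally show ?thesis by (simp add: n_def)
qed

text \<open>The inner loop is the Nesterov analysis with zero gradient error. It restarts at 0, so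
  the error is relative to \<open>norm (ys x)\<close>; strong convexity converts the gap into a
  distance and produces the factor \<open>2 * (Lt_y / \<mu>)\<close>.\<close>

lemma inner_error:
  assumes "2 * (Lt_y / \<mu>) * (1 - sqrt (\<mu> / Lt_y) / 4) ^ N \<le> \<delta>\<^sup>2" "0 \<le> \<delta>"
  shows "norm (fst (accbio_inner g Lt_y \<mu> x N) - ys x) \<le> \<delta> * norm (ys x)"
proof -
  interpret nesterov_objective "g x" "dg x" Lt_y \<mu> "sqrt (\<mu> / Lt_y)" "ys x"
    by (rule nesterov_inner)
  define q where "q = sqrt (\<mu> / Lt_y)"
  have coeffs: "2 * sqrt (Lt_y / \<mu>) / (sqrt (Lt_y / \<mu>) + 1) = 1 + (1 - q) / (1 + q)"
    "(sqrt (Lt_y / \<mu>) - 1) / (sqrt (Lt_y / \<mu>) + 1) = (1 - q) / (1 + q)"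
    using momentum_coefficients[of \<mu> Lt_y] \<mu>_pos Lt_y_pos by (simp_all add: q_def)
  define y s where "y t = fst (accbio_inner g Lt_y \<mu> x t)" and "s t = snd (accbio_inner g Lt_y \<mu> x t)" for t
  define e where "e = norm (y N - ys x)"
  have "g x (y N) - g x (ys x) \<le> (1 - sqrt (\<mu> / Lt_y) / 4) ^ N * (Lt_y * (norm (y 0 - ys x))\<^sup>2) + 0"
  proof (rule inexact_nesterov[where x = s and G = "\<lambda>t. dg x (s t)" and \<zeta> = 0])
    show "y (Suc k) = s k - (1 / Lt_y) *\<^sub>R dg x (s k)" for k
      by (simp add: y_def s_def Let_def split_beta grad_y_g)
    show "s (Suc k) = (1 + (1 - sqrt (\<mu> / Lt_y)) / (1 + sqrt (\<mu> / Lt_y))) *\<^sub>R y (Suc k)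
        - ((1 - sqrt (\<mu> / Lt_y)) / (1 + sqrt (\<mu> / Lt_y))) *\<^sub>R y k" for k
      unfolding q_def[symmetric] coeffs(1)[symmetric] unfolding coeffs(2)[symmetric]
      by (simp add: y_def s_def Let_def split_beta grad_y_g)
  qed (auto simp: y_def s_def)
  then have "\<mu> / 2 * e\<^sup>2 \<le> (1 - sqrt (\<mu> / Lt_y) / 4) ^ N * (Lt_y * (norm (ys x))\<^sup>2)"
    using quadratic_growth[of "y N"] by (simp add: y_def e_def)
  then have "e\<^sup>2 \<le> 2 * (Lt_y / \<mu>) * (1 - sqrt (\<mu> / Lt_y) / 4) ^ N * (norm (ys x))\<^sup>2"
    using \<mu>_pos by (simp add: field_simps)
  also have "\<dots> \<le> \<delta>\<^sup>2 * (norm (ys x))\<^sup>2"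
    using assms by (intro mult_right_mono) auto
  finally have "e\<^sup>2 \<le> (\<delta> * norm (ys x))\<^sup>2"
    by (simp add: power_mult_distrib)
  then show ?thesis
    unfolding e_def y_def by (rule power2_le_imp_le) (use assms in simp)
qed

lemma grad_x_regularized: "grad_x (regularized \<epsilon> R f) x y = grad_x f x y + (\<epsilon> / R) *\<^sub>R x"
  unfolding grad_x_def[of "regularized \<epsilon> R f"] regularized_def
  by (rule grad_eqI) (intro GDERIV_add GDERIV_f GDERIV_sq_norm)

lemma grad_y_regularized: "grad_y (regularized \<epsilon> R f) x y = grad_y f x y"
  using GDERIV_add[OF GDERIV_f(2)[of x y] GDERIV_const]
  unfolding grad_y_def[of "regularized \<epsilon> R f"] regularized_def by (intro grad_eqI) simp

lemma grad_quadratic: "grad (\<lambda>v. 1 / 2 * (v \<bullet> (H *v v)) - v \<bullet> d) v = H *v v - d"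
proof (rule grad_eqI)
  have lin: "((\<lambda>y. H *v y) has_derivative (\<lambda>k. H *v k)) (at v)"
    by (rule bounded_linear_imp_has_derivative) simp
  have "((\<lambda>v. 1 / 2 * (v \<bullet> (H *v v)) - v \<bullet> d) has_derivative
      (\<lambda>k. 1 / 2 * (v \<bullet> (H *v k) + k \<bullet> (H *v v)) - k \<bullet> d)) (at v)"
    by (auto intro!: derivative_eq_intros lin)
  moreover have "1 / 2 * (v \<bullet> (H *v k) + k \<bullet> (H *v v)) - k \<bullet> d = k \<bullet> (H *v v - d)" for k
    using H_inner[of v k] inner_commute[of k "H *v v"] by (simp add: inner_diff_right)
  ultimately show "GDERIV (\<lambda>v. 1 / 2 * (v \<bullet> (H *v v)) - v \<bullet> d) v :> H *v v - d"
    unfolding gderiv_def by simp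
qed

text \<open>Three errors add up: the inexact \<open>y\<close> in the \<open>x\<close>-gradient, the
  inexact \<open>y\<close> in the right-hand side of the linear system, and the truncated heavy-ball
  iteration. The second derivatives of \<open>g\<close> are constant and contribute none. The factor
  2 arises because \<open>L_y\<close> enters through both the size of \<open>d\<close> and the
  difference \<open>d - d'\<close>.\<close>

lemma estimate_error:
  assumes lam: "lam = 4 / (sqrt Lt_y + sqrt \<mu>)\<^sup>2"
    and \<theta>: "\<theta> = max ((1 - sqrt (lam * \<mu>))\<^sup>2) ((1 - sqrt (lam * Lt_y))\<^sup>2)"
    and \<delta>: "0 \<le> \<delta>" "\<delta> \<le> 1"
    and N: "2 * (Lt_y / \<mu>) * (1 - sqrt (\<mu> / Lt_y) / 4) ^ N \<le> \<delta>\<^sup>2"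
    and m: "8 / sqrt (\<mu> / Lt_y) * (1 - sqrt (\<mu> / Lt_y) / 4) ^ m \<le> \<delta>"
  shows "norm (hypergrad_estimate (regularized \<epsilon> R f) g Lt_y \<mu> lam \<theta> N (Suc m) x - (dPhi x + (\<epsilon> / R) *\<^sub>R x))
    \<le> \<delta> * ((L_xy + 2 * L_y * Lt_xy / \<mu>) * norm (ys x) + Lt_xy / \<mu> * norm (grad_y f x (ys x)))"
proof -
  define y where "y = fst (accbio_inner g Lt_y \<mu> x N)"
  define d d' where "d = grad_y f x y" and "d' = grad_y f x (ys x)"
  define v where "v = heavy_ball (\<lambda>v. 1 / 2 * (v \<bullet> (H *v v)) - v \<bullet> d) lam \<theta> (Suc m)"
  define n where "n = norm (ys x)"
  have y: "norm (y - ys x) \<le> \<delta> * n"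
    unfolding y_def n_def by (rule inner_error[OF N \<delta>(1)])
  also have "\<dots> \<le> 1 * n"
    using \<delta> by (intro mult_right_mono) (auto simp: n_def)
  finally have y': "norm (y - ys x) \<le> n" by simp
  have dd: "norm (d - d') \<le> L_y * norm (y - ys x)"
    using grad_y_diff[of x y x "ys x"] by (simp add: d_def d'_def)
  have "norm (v - Hi *v d) \<le> 8 / sqrt (\<mu> / Lt_y) * (1 - sqrt (\<mu> / Lt_y) / 4) ^ m * norm (Hi *v d)"
    unfolding v_def
    by (rule heavy_ball_convergence[OF _ H_inner H_lower H_upper \<mu>_pos \<mu>_le lam \<theta>])
      (simp, simp only: grad_quadratic H_Hi)
  also have "\<dots> \<le> \<delta> * norm (Hi *v d)"
    by (intro mult_right_mono m) simp
  also have "\<dots> \<le> \<delta> * ((norm d' + L_y * n) / \<mu>)"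
  proof (rule mult_left_mono)
    have "norm d \<le> norm d' + norm (d - d')"
      using norm_triangle_ineq[of d' "d - d'"] by simp
    also have "\<dots> \<le> norm d' + L_y * n"
      using dd mult_left_mono[OF y' constants_nonneg(3)] by simp
    finally have "norm d / \<mu> \<le> (norm d' + L_y * n) / \<mu>"
      using \<mu>_pos by (intro divide_right_mono) auto
    then show "norm (Hi *v d) \<le> (norm d' + L_y * n) / \<mu>"
      using norm_Hi[of d] by linarith
  qed (rule \<delta>)
  finally have v: "norm (v - Hi *v d) \<le> \<delta> * ((norm d' + L_y * n) / \<mu>)" .
  have "L_y * norm (y - ys x) \<le> L_y * (\<delta> * n)"
    using y constants_nonneg by (intro mult_left_mono) auto
  with dd have "norm (d - d') \<le> L_y * (\<delta> * n)" by linarith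
  then have "norm (Hi *v (d - d')) \<le> L_y * (\<delta> * n) / \<mu>"
    using norm_Hi[of "d - d'"] divide_right_mono[of "norm (d - d')" "L_y * (\<delta> * n)" \<mu>] \<mu>_pos by linarith
  moreover have "norm (v - Hi *v d') \<le> norm (v - Hi *v d) + norm (Hi *v (d - d'))"
    using norm_triangle_ineq[of "v - Hi *v d" "Hi *v (d - d')"] by (simp add: H_diff)
  ultimately have "norm (v - Hi *v d') \<le> \<delta> * ((norm d' + L_y * n) / \<mu>) + L_y * (\<delta> * n) / \<mu>"
    using v by linarith
  then have "Lt_xy * norm (v - Hi *v d') \<le> Lt_xy * (\<delta> * ((norm d' + L_y * n) / \<mu>) + L_y * (\<delta> * n) / \<mu>)"
    by (intro mult_left_mono constants_nonneg)
  moreover have "norm (grad_x f x y - grad_x f x (ys x)) \<le> L_xy * (\<delta> * n)"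
    using grad_x_diff[of x y x "ys x"] mult_left_mono[OF y constants_nonneg(2)] by simp
  moreover have "hypergrad_estimate (regularized \<epsilon> R f) g Lt_y \<mu> lam \<theta> N (Suc m) x - (dPhi x + (\<epsilon> / R) *\<^sub>R x)
      = (grad_x f x y - grad_x f x (ys x)) - J *v (v - Hi *v d')"
    by (simp only: hypergrad_estimate_def Let_def grad_x_regularized grad_y_regularized hess_yy_g hess_xy_g
        y_def[symmetric] d_def[symmetric] v_def[symmetric] dPhi_def d'_def H_diff) simp
  ultimately have "norm (hypergrad_estimate (regularized \<epsilon> R f) g Lt_y \<mu> lam \<theta> N (Suc m) x - (dPhi x + (\<epsilon> / R) *\<^sub>R x))
      \<le> L_xy * (\<delta> * n) + Lt_xy * (\<delta> * ((norm d' + L_y * n) / \<mu>) + L_y * (\<delta> * n) / \<mu>)"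
    using norm_J[of "v - Hi *v d'"] norm_triangle_ineq4[of "grad_x f x y - grad_x f x (ys x)" "J *v (v - Hi *v d')"]
    by simp
  also have "\<dots> = \<delta> * ((L_xy + 2 * L_y * Lt_xy / \<mu>) * n + Lt_xy / \<mu> * norm d')"
    using \<mu>_pos by (simp add: field_simps)
  finally show ?thesis by (simp add: n_def d'_def)
qed

section \<open>The regularized hyperobjective and the outer loop\<close>

definition dPhi_reg :: "real \<Rightarrow> real \<Rightarrow> real^'p \<Rightarrow> real^'p" where
  "dPhi_reg \<epsilon> R x = dPhi x + (\<epsilon> / R) *\<^sub>R x"

lemma Phi_regularized: "Phi (regularized \<epsilon> R f) g x = Phi f g x + \<epsilon> / (2 * R) * (norm x)\<^sup>2"
  by (simp add: Phi_def regularized_def)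

lemma GDERIV_Phi_reg: "GDERIV (Phi (regularized \<epsilon> R f) g) x :> dPhi_reg \<epsilon> R x"
  unfolding dPhi_reg_def Phi_regularized[abs_def] by (intro GDERIV_add GDERIV_Phi GDERIV_sq_norm)

lemma grad_Phi: "grad (Phi f g) x = dPhi x"
  by (rule grad_eqI) (rule GDERIV_Phi)

lemma lipschitz_Phi_reg:
  assumes "0 \<le> \<epsilon> / R" "L_Phi + \<epsilon> / R \<le> L"
  shows "L-lipschitz_on UNIV (dPhi_reg \<epsilon> R)"
proof (rule lipschitz_onI)
  have "0 \<le> L_Phi"
    using constants_nonneg \<mu>_pos by (simp add: L_Phi_def)
  then show "0 \<le> L" using assms by simp
  fix x x' :: "real^'p"
  have "dPhi_reg \<epsilon> R x - dPhi_reg \<epsilon> R x' = (dPhi x - dPhi x') + (\<epsilon> / R) *\<^sub>R (x - x')"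
    by (simp add: dPhi_reg_def scaleR_diff_right)
  then have "norm (dPhi_reg \<epsilon> R x - dPhi_reg \<epsilon> R x') \<le> norm (dPhi x - dPhi x') + norm ((\<epsilon> / R) *\<^sub>R (x - x'))"
    by (simp only: norm_triangle_ineq)
  also have "norm ((\<epsilon> / R) *\<^sub>R (x - x')) = \<epsilon> / R * norm (x - x')"
    by (simp only: norm_scaleR abs_of_nonneg[OF assms(1)])
  also have "norm (dPhi x - dPhi x') + \<epsilon> / R * norm (x - x') \<le> (L_Phi + \<epsilon> / R) * norm (x - x')"
    using dPhi_lipschitz[of x x'] by (simp add: distrib_right)
  also have "\<dots> \<le> L * norm (x - x')"
    using assms by (intro mult_right_mono) auto
  finally show "dist (dPhi_reg \<epsilon> R x) (dPhi_reg \<epsilon> R x') \<le> L * dist x x'"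
    by (simp add: dist_norm)
qed

lemma smooth_Phi_reg:
  assumes "0 \<le> \<epsilon> / R" "L_Phi + \<epsilon> / R \<le> L"
  shows "smooth_fun L (Phi (regularized \<epsilon> R f) g)"
proof -
  have "grad (Phi (regularized \<epsilon> R f) g) = dPhi_reg \<epsilon> R"
    using grad_eqI[OF GDERIV_Phi_reg] by blast
  moreover have "Phi (regularized \<epsilon> R f) g differentiable (at x)" for x
    using GDERIV_Phi_reg unfolding gderiv_def differentiable_def by blast
  ultimately show ?thesis
    using lipschitz_Phi_reg[OF assms] by (simp add: smooth_fun_def)
qed

text \<open>A minimizer over the ball of radius \<open>B\<close> exists by compactness. It is
  global, since outside the ball \<open>xs\<close> has both the smaller value of
  \<open>Phi f g\<close> and the smaller norm.\<close>

lemma regularized_minimizer: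
  assumes xs: "is_arg_min (Phi f g) (\<lambda>_. True) xs" "norm xs = B" and c: "0 < \<epsilon> / R"
  obtains xo where "norm xo \<le> B" "\<And>u. Phi (regularized \<epsilon> R f) g xo \<le> Phi (regularized \<epsilon> R f) g u"
proof -
  let ?F = "Phi (regularized \<epsilon> R f) g"
  have min: "Phi f g xs \<le> Phi f g u" for u
    using xs(1) by (simp add: is_arg_min_def not_less)
  have "continuous_on (cball 0 B) ?F"
    using GDERIV_Phi_reg unfolding gderiv_def
    by (meson continuous_at_imp_continuous_on has_derivative_continuous)
  moreover have "compact (cball (0::real^'p) B)" "cball (0::real^'p) B \<noteq> {}"
    using B_pos by auto
  ultimately obtain xo where xo: "xo \<in> cball 0 B" "\<And>u. u \<in> cball 0 B \<Longrightarrow> ?F xo \<le> ?F u"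
    by (metis continuous_attains_inf)
  have "?F xo \<le> ?F u" for u
  proof (cases "norm u \<le> B")
    case False
    have "?F xo \<le> ?F xs" using xs by (intro xo) simp
    also have "\<dots> \<le> ?F u"
    proof -
      have "(norm xs)\<^sup>2 \<le> (norm u)\<^sup>2" using False xs(2) by (intro power_mono) auto
      then have "\<epsilon> / R / 2 * (norm xs)\<^sup>2 \<le> \<epsilon> / R / 2 * (norm u)\<^sup>2"
        using c by (intro mult_left_mono) auto
      then show ?thesis using min[of u] by (simp add: Phi_regularized mult.commute[of R])
    qed
    finally show ?thesis .
  qed (use xo in simp)
  with xo(1) that show ?thesis by simp
qed

text \<open>Convexity of \<open>Phi f g\<close> gives its tangent bound, and the regularizer, being
  quadratic, adds its exact second-order term; this supplies the strong convexity constant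
  \<open>\<epsilon> / R\<close>.\<close>

lemma nesterov_outer:
  assumes c: "0 < \<epsilon> / R" and L: "L_Phi + \<epsilon> / R \<le> L"
    and xo: "\<And>u. Phi (regularized \<epsilon> R f) g xo \<le> Phi (regularized \<epsilon> R f) g u"
  shows "nesterov_objective (Phi (regularized \<epsilon> R f) g) (dPhi_reg \<epsilon> R) L (\<epsilon> / R) (sqrt (\<epsilon> / R / L)) xo"
proof
  have "0 \<le> L_Phi"
    using constants_nonneg \<mu>_pos by (simp add: L_Phi_def)
  then show "\<epsilon> / R \<le> L" using L by simp
  show "Phi (regularized \<epsilon> R f) g u \<le> Phi (regularized \<epsilon> R f) g v + dPhi_reg \<epsilon> R v \<bullet> (u - v)
      + L / 2 * (norm (u - v))\<^sup>2" for u v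
    using c L by (intro descent_inequality GDERIV_Phi_reg lipschitz_Phi_reg) auto
  show "Phi (regularized \<epsilon> R f) g v + dPhi_reg \<epsilon> R v \<bullet> (u - v) + \<epsilon> / R / 2 * (norm (u - v))\<^sup>2
      \<le> Phi (regularized \<epsilon> R f) g u" for u v
  proof -
    have "Phi f g v + dPhi v \<bullet> (u - v) \<le> Phi f g u"
      by (rule convex_on_gradient[OF convex_Phi GDERIV_Phi])
    moreover have "a / 2 * (norm u)\<^sup>2 = a / 2 * (norm v)\<^sup>2 + (a *\<^sub>R v) \<bullet> (u - v)
        + a / 2 * (norm (u - v))\<^sup>2" for a
      unfolding power2_norm_eq_inner by (simp add: inner_diff_left inner_diff_right inner_commute field_simps)
    note this[of "\<epsilon> / R"]
    ultimately show ?thesis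
      by (simp add: Phi_regularized dPhi_reg_def inner_add_left mult.commute[of R])
  qed
qed (use c xo in auto)

text \<open>A gradient step from \<open>xo\<close> lowers \<open>Phi f g\<close> by the squared
  gradient over \<open>2 * L\<close>, so optimality of \<open>xs\<close> sharpens the convexity
  inequality between \<open>xo\<close> and \<open>xs\<close> by that amount. As the gradient at
  \<open>xo\<close> is a multiple of \<open>xo\<close>, this improves \<open>norm xo \<le> B\<close>
  by a definite factor.\<close>

lemma minimizer_slack:
  assumes c: "0 < \<epsilon> / R" and L: "L_Phi + \<epsilon> / R \<le> L"
    and xo: "\<And>u. Phi (regularized \<epsilon> R f) g xo \<le> Phi (regularized \<epsilon> R f) g u"
    and xs: "is_arg_min (Phi f g) (\<lambda>_. True) xs" "norm xs = B"
  shows "norm xo * (1 + \<epsilon> / R / (2 * L)) \<le> B"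
proof -
  interpret nesterov_objective "Phi (regularized \<epsilon> R f) g" "dPhi_reg \<epsilon> R" L "\<epsilon> / R" "sqrt (\<epsilon> / R / L)" xo
    by (rule nesterov_outer[OF c L xo])
  define c where "c = \<epsilon> / R"
  have c_pos: "0 < c" using mu_pos by (simp add: c_def)
  have dPhi_xo: "dPhi xo = - (c *\<^sub>R xo)"
    using gradient_xo by (simp add: dPhi_reg_def c_def eq_neg_iff_add_eq_0)
  define u where "u = xo - (1 / L) *\<^sub>R dPhi xo"
  have "L-lipschitz_on UNIV dPhi"
  proof (rule lipschitz_onI)
    show "dist (dPhi x) (dPhi x') \<le> L * dist x x'" for x x'
    proof -
      have "L_Phi * norm (x - x') \<le> L * norm (x - x')"
        using L assms(1) by (intro mult_right_mono) auto
      then show ?thesis using dPhi_lipschitz[of x x'] by (simp add: dist_norm)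
    qed
  qed (use L_pos in simp)
  then have "Phi f g u \<le> Phi f g xo + dPhi xo \<bullet> (u - xo) + L / 2 * (norm (u - xo))\<^sup>2"
    by (intro descent_inequality GDERIV_Phi)
  also have "\<dots> = Phi f g xo - (norm (dPhi xo))\<^sup>2 / (2 * L)"
    using L_pos unfolding power2_norm_eq_inner
    by (simp add: u_def field_simps power2_eq_square)
  finally have "Phi f g xs \<le> Phi f g xo - c\<^sup>2 * (norm xo)\<^sup>2 / (2 * L)"
    using xs(1) order_trans[of "Phi f g xs" "Phi f g u"]
    by (auto simp: is_arg_min_def not_less dPhi_xo power_mult_distrib)
  moreover have "Phi f g xo + dPhi xo \<bullet> (xs - xo) \<le> Phi f g xs"
    by (rule convex_on_gradient[OF convex_Phi GDERIV_Phi])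
  ultimately have "c\<^sup>2 * (norm xo)\<^sup>2 / (2 * L) \<le> c * (xo \<bullet> (xs - xo))"
    unfolding dPhi_xo by simp
  also have "\<dots> = c * (xo \<bullet> xs - (norm xo)\<^sup>2)"
    by (simp add: inner_diff_right power2_norm_eq_inner)
  finally have "c * ((norm xo)\<^sup>2 * (1 + c / (2 * L))) \<le> c * (xo \<bullet> xs)"
    by (simp add: algebra_simps power2_eq_square)
  then have "(norm xo)\<^sup>2 * (1 + c / (2 * L)) \<le> xo \<bullet> xs"
    using c_pos by simp
  also have "\<dots> \<le> norm xo * B"
    using norm_cauchy_schwarz[of xo xs] xs by simp
  finally have "norm xo * (norm xo * (1 + c / (2 * L))) \<le> norm xo * B"
    by (simp add: power2_eq_square mult.assoc)
  then show ?thesis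
    using B_pos unfolding c_def[symmetric] by (cases "xo = 0") auto
qed

lemma accbio_convergence:
  assumes c: "0 < \<epsilon> / R" and L: "L_Phi + \<epsilon> / R \<le> L"
    and xo: "\<And>u. Phi (regularized \<epsilon> R f) g xo \<le> Phi (regularized \<epsilon> R f) g u"
    and err: "\<And>x. norm (hypergrad_estimate (regularized \<epsilon> R f) g Lt_y \<mu> lam \<theta> N M x - dPhi_reg \<epsilon> R x)
        \<le> \<zeta> * (1 + norm (x - xo))"
    and \<zeta>: "32 * \<zeta>\<^sup>2 \<le> (\<epsilon> / R)\<^sup>2" "16 * \<zeta>\<^sup>2 \<le> \<epsilon> / R * \<eta>"
  shows "Phi (regularized \<epsilon> R f) g (accbio_z (regularized \<epsilon> R f) g L (\<epsilon> / R) Lt_y \<mu> lam \<theta> N M K)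
      - Phi (regularized \<epsilon> R f) g xo
    \<le> (1 - sqrt (\<epsilon> / R / L) / 4) ^ K * (L * (norm xo)\<^sup>2) + \<eta>"
proof -
  interpret nesterov_objective "Phi (regularized \<epsilon> R f) g" "dPhi_reg \<epsilon> R" L "\<epsilon> / R" "sqrt (\<epsilon> / R / L)" xo
    by (rule nesterov_outer[OF c L xo])
  define q where "q = sqrt (\<epsilon> / R / L)"
  have coeff: "(sqrt (L / (\<epsilon> / R)) - 1) / (sqrt (L / (\<epsilon> / R)) + 1) = (1 - q) / (1 + q)"
    using momentum_coefficients(1)[of "\<epsilon> / R" L] mu_pos L_pos by (simp add: q_def)
  define z x where "z k = fst (accbio (regularized \<epsilon> R f) g L (\<epsilon> / R) Lt_y \<mu> lam \<theta> N M k)"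
    and "x k = snd (accbio (regularized \<epsilon> R f) g L (\<epsilon> / R) Lt_y \<mu> lam \<theta> N M k)" for k
  have "Phi (regularized \<epsilon> R f) g (z K) - Phi (regularized \<epsilon> R f) g xo
    \<le> (1 - sqrt (\<epsilon> / R / L) / 4) ^ K * (L * (norm (z 0 - xo))\<^sup>2) + \<eta>"
  proof (rule inexact_nesterov[where x = x and \<zeta> = \<zeta>
        and G = "\<lambda>k. hypergrad_estimate (regularized \<epsilon> R f) g Lt_y \<mu> lam \<theta> N M (x k)"])
    show "z (Suc k) = x k - (1 / L) *\<^sub>R hypergrad_estimate (regularized \<epsilon> R f) g Lt_y \<mu> lam \<theta> N M (x k)" for k
      by (simp add: z_def x_def Let_def split_beta)
    show "x (Suc k) = (1 + (1 - sqrt (\<epsilon> / R / L)) / (1 + sqrt (\<epsilon> / R / L))) *\<^sub>R z (Suc k)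
        - ((1 - sqrt (\<epsilon> / R / L)) / (1 + sqrt (\<epsilon> / R / L))) *\<^sub>R z k" for k
      unfolding q_def[symmetric] coeff[symmetric] by (simp add: z_def x_def Let_def split_beta)
  qed (use \<zeta> err in \<open>auto simp: z_def x_def\<close>)
  then show ?thesis by (simp add: z_def accbio_z_def)
qed

end

section \<open>Choice of the parameters\<close>

text \<open>Since \<open>T\<close> is at least 3, a numerical constant up to \<open>3 ^ k\<close>
  costs \<open>k\<close> further factors \<open>T\<close>; this reduces the error bookkeeping to
  comparing exponents.\<close>

lemma absorb_power:
  fixes T a :: real
  assumes "3 \<le> T" "a \<le> 3 ^ k" "k + i \<le> j"
  shows "a * T ^ i \<le> T ^ j"
proof -
  have "a \<le> T ^ k"
    using assms power_mono[of 3 T k] by simp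
  then have "a * T ^ i \<le> T ^ k * T ^ i"
    using assms by (intro mult_right_mono) auto
  also have "\<dots> = T ^ (k + i)" by (simp add: power_add)
  also have "\<dots> \<le> T ^ j"
    using assms by (intro power_increasing) auto
  finally show ?thesis .
qed

lemma absorb_inverse_power:
  fixes T a :: real
  assumes "3 \<le> T" "a \<le> 3 ^ k" "j + k \<le> i"
  shows "a / T ^ i \<le> 1 / T ^ j"
  using absorb_power[OF assms(1,2), of j i] assms by (simp add: field_simps)

text \<open>
  Below \<open>T\<close> dominates all problem quantities and the inverses of the small ones. Every error is
  compared with a power of \<open>T\<close>, so that all iteration counts carry a factor \<open>ln T\<close> only.
\<close>

context quadratic_bilevel
begin

text \<open>Brings the error into the shape that \<open>inexact_nesterov\<close> expects.
  \<open>ys\<close> and the \<open>y\<close>-gradient of \<open>f\<close> grow linearly away from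
  \<open>xs\<close>, where their norms are at most \<open>T\<close>, and \<open>xs\<close> lies
  within \<open>2 * B\<close> of \<open>xo\<close>.\<close>

lemma error_coefficient_bound:
  assumes T: "3 \<le> T" "L_xy \<le> T" "L_y \<le> T" "Lt_xy \<le> T" "1 / \<mu> \<le> T" "B \<le> T"
    "norm (ys xs) \<le> T" "norm (grad_y f xs (ys xs)) \<le> T"
    and B: "norm xo \<le> B" "norm xs = B"
  shows "(L_xy + 2 * L_y * Lt_xy / \<mu>) * norm (ys x) + Lt_xy / \<mu> * norm (grad_y f x (ys x))
    \<le> T ^ 9 * (1 + norm (x - xo))"
proof -
  define n where "n = norm (x - xo)"
  define n' where "n' = norm (x - xs)"
  have n: "0 \<le> n" by (simp add: n_def)
  have "n' \<le> norm (x - xo) + norm (xo - xs)"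
    using norm_triangle_ineq[of "x - xo" "xo - xs"] by (simp add: n'_def)
  then have n': "n' \<le> n + 2 * T" "0 \<le> n'"
    using norm_triangle_ineq4[of xo xs] B T by (simp_all add: n_def n'_def)
  have T_powers: "1 \<le> T" "T ^ i \<le> T ^ j" if "i \<le> j" for i j
    using that T(1) by (auto intro: power_increasing)
  have r: "0 \<le> Lt_xy / \<mu>" "Lt_xy / \<mu> \<le> T ^ 2"
    using mult_mono[OF T(4,5)] constants_nonneg \<mu>_pos T(1) by (simp_all add: power2_eq_square)
  have r3: "L_y * (Lt_xy / \<mu>) \<le> T * T ^ 2"
    using r T constants_nonneg by (intro mult_mono) auto
  have a: "L_xy + 2 * L_y * Lt_xy / \<mu> \<le> T ^ 4"
  proof -
    have "L_xy + 2 * L_y * Lt_xy / \<mu> \<le> T ^ 1 + 2 * T ^ 3"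
      using r3 T(2) by (simp add: eval_nat_numeral)
    also have "\<dots> \<le> 3 * T ^ 3"
      using T_powers(2)[of 1 3] by simp
    also have "\<dots> \<le> T ^ 4" using T(1) by (rule absorb_power[of _ _ 1]) auto
    finally show ?thesis .
  qed
  have y: "norm (ys x) \<le> T ^ 4 * (1 + n)"
  proof -
    have "norm (ys x) \<le> T + Lt_xy / \<mu> * n'"
      using norm_triangle_ineq[of "ys xs" "ys x - ys xs"] ys_lipschitz[of x xs] T by (simp add: n'_def)
    also have "\<dots> \<le> T ^ 1 + T ^ 2 * (n + 2 * T)"
      using r n' T by (intro add_mono mult_mono) auto
    also have "\<dots> = T ^ 1 + 2 * T ^ 3 + T ^ 2 * n"
      by (simp add: algebra_simps eval_nat_numeral)
    also have "\<dots> \<le> T ^ 4 + T ^ 4 * n"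
    proof (intro add_mono mult_right_mono n T_powers(2))
      have "T ^ 1 + 2 * T ^ 3 \<le> 3 * T ^ 3"
        using T_powers(2)[of 1 3] by simp
      also have "\<dots> \<le> T ^ 4" using T(1) by (rule absorb_power[of _ _ 1]) auto
      finally show "T ^ 1 + 2 * T ^ 3 \<le> T ^ 4" .
    qed simp
    finally show ?thesis by (simp add: algebra_simps)
  qed
  have d: "norm (grad_y f x (ys x)) \<le> T ^ 6 * (1 + n)"
  proof -
    have "norm (ys x - ys xs) \<le> Lt_xy / \<mu> * n'"
      using ys_lipschitz[of x xs] by (simp add: n'_def)
    then have "L_y * norm (ys x - ys xs) \<le> L_y * (Lt_xy / \<mu> * n')"
      using constants_nonneg by (intro mult_left_mono) auto
    then have "norm (grad_y f x (ys x)) \<le> T + (L_xy * n' + L_y * (Lt_xy / \<mu>) * n')"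
      using norm_triangle_ineq[of "grad_y f xs (ys xs)" "grad_y f x (ys x) - grad_y f xs (ys xs)"]
        grad_y_diff[of x "ys x" xs "ys xs"] T by (simp add: n'_def)
    also have "\<dots> = T + (L_xy + L_y * (Lt_xy / \<mu>)) * n'"
      by (simp add: algebra_simps)
    also have "\<dots> \<le> T ^ 1 + (2 * T ^ 3) * (n + 2 * T)"
    proof (intro add_mono mult_mono n')
      show "L_xy + L_y * (Lt_xy / \<mu>) \<le> 2 * T ^ 3"
        using r3 T(2) T_powers(2)[of 1 3] by (simp add: eval_nat_numeral)
    qed (use T n' in auto)
    also have "\<dots> = T ^ 1 + 4 * T ^ 4 + 2 * T ^ 3 * n"
      by (simp add: algebra_simps eval_nat_numeral)
    also have "\<dots> \<le> T ^ 6 + T ^ 6 * n"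
    proof (intro add_mono mult_right_mono n)
      have "T ^ 1 + 4 * T ^ 4 \<le> 5 * T ^ 4"
        using T_powers(2)[of 1 4] by simp
      also have "\<dots> \<le> T ^ 6" using T(1) by (rule absorb_power[of _ _ 2]) auto
      finally show "T ^ 1 + 4 * T ^ 4 \<le> T ^ 6" .
      show "2 * T ^ 3 \<le> T ^ 6" using T(1) by (rule absorb_power[of _ _ 1]) auto
    qed
    finally show ?thesis by (simp add: algebra_simps)
  qed
  have "(L_xy + 2 * L_y * Lt_xy / \<mu>) * norm (ys x) + Lt_xy / \<mu> * norm (grad_y f x (ys x))
      \<le> T ^ 4 * (T ^ 4 * (1 + n)) + T ^ 2 * (T ^ 6 * (1 + n))"
    using a y r d T(1) by (intro add_mono mult_mono) auto
  also have "\<dots> = 2 * T ^ 8 * (1 + n)"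
    by (simp add: algebra_simps flip: power_add)
  also have "\<dots> \<le> T ^ 9 * (1 + n)"
    using T(1) n by (intro mult_right_mono absorb_power[of _ _ 1]) auto
  finally show ?thesis by (simp add: n_def)
qed

text \<open>All iteration counts provide a decay of \<open>1 / T ^ 100\<close>. The losses along the
  way are fixed powers of \<open>T\<close>, so the final gap is still
  \<open>2 / T ^ 50\<close>.\<close>

lemma accbio_accuracy:
  assumes lam: "lam = 4 / (sqrt Lt_y + sqrt \<mu>)\<^sup>2"
    and \<theta>: "\<theta> = max ((1 - sqrt (lam * \<mu>))\<^sup>2) ((1 - sqrt (lam * Lt_y))\<^sup>2)"
    and xs: "is_arg_min (Phi f g) (\<lambda>_. True) xs" "norm xs = B"
    and T: "3 \<le> T" "L_xy \<le> T" "L_y \<le> T" "Lt_xy \<le> T" "1 / \<mu> \<le> T" "B \<le> T"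
    "norm (ys xs) \<le> T" "norm (grad_y f xs (ys xs)) \<le> T" "Lt_y \<le> T"
    and c: "0 < \<epsilon> / R" "1 / T ^ 3 \<le> \<epsilon> / R"
    and L: "L_Phi + \<epsilon> / R \<le> L" "L \<le> T ^ 7"
    and m: "4 / sqrt (\<mu> / Lt_y) * (100 * ln T) \<le> real m"
    and K: "4 / sqrt (\<epsilon> / R / L) * (100 * ln T) \<le> real K"
  obtains xo where "norm xo \<le> B" "\<forall>u. Phi (regularized \<epsilon> R f) g xo \<le> Phi (regularized \<epsilon> R f) g u"
    "Phi (regularized \<epsilon> R f) g
        (accbio_z (regularized \<epsilon> R f) g L (\<epsilon> / R) Lt_y \<mu> lam \<theta> (Suc m) (Suc m) K)
      - Phi (regularized \<epsilon> R f) g xo \<le> 2 / T ^ 50"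
proof -
  obtain xo where xo: "norm xo \<le> B" "\<And>u. Phi (regularized \<epsilon> R f) g xo \<le> Phi (regularized \<epsilon> R f) g u"
    using regularized_minimizer[OF xs c(1)] by blast
  interpret nesterov_objective "Phi (regularized \<epsilon> R f) g" "dPhi_reg \<epsilon> R" L "\<epsilon> / R" "sqrt (\<epsilon> / R / L)" xo
    by (rule nesterov_outer[OF c(1) L(1) xo(2)])
  define q where "q = sqrt (\<mu> / Lt_y)"
  define \<kappa> where "\<kappa> = Lt_y / \<mu>"
  have q: "0 < q" "q \<le> 1" using \<mu>_pos \<mu>_le Lt_y_pos by (simp_all add: q_def)
  have \<kappa>: "1 \<le> \<kappa>" "\<kappa> \<le> T ^ 2" "1 / q \<le> \<kappa>"
  proof -
    show "1 \<le> \<kappa>" using \<mu>_pos \<mu>_le by (simp add: \<kappa>_def)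
    show "\<kappa> \<le> T ^ 2"
      using mult_mono[OF T(9,5)] \<mu>_pos T(1) by (simp add: \<kappa>_def power2_eq_square)
    have "1 / q = sqrt \<kappa>" by (simp add: q_def \<kappa>_def real_sqrt_divide)
    also have "\<dots> \<le> \<kappa>" using \<open>1 \<le> \<kappa>\<close> by (simp add: sqrt_le_D real_le_lsqrt power2_eq_square)
    finally show "1 / q \<le> \<kappa>" .
  qed
  have T0: "0 < T" "1 \<le> T" using T(1) by simp_all
  have decay: "(1 - q / 4) ^ m \<le> 1 / T ^ 100"
    using m q T0 by (intro one_minus_power_le_exp) (simp_all add: q_def)
  have decay_Suc: "(1 - q / 4) ^ Suc m \<le> 1 / T ^ 100"
  proof -
    have "(1 - q / 4) ^ Suc m \<le> 1 * (1 - q / 4) ^ m"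
      unfolding power_Suc using q by (intro mult_right_mono) auto
    with decay show ?thesis by simp
  qed
  \<comment> \<open>The exponent 40 lies in a wide window: the square \<open>1 / T ^ 80\<close> must
    exceed the inner error of about \<open>T ^ 2 / T ^ 100\<close>, while the coefficient
    \<open>T ^ 9\<close> must leave a small error, here \<open>1 / T ^ 31\<close>.\<close>
  define \<delta> where "\<delta> = 1 / T ^ 40"
  have \<delta>: "0 \<le> \<delta>" "\<delta> \<le> 1" using T0 by (simp_all add: \<delta>_def)
  have N: "2 * (Lt_y / \<mu>) * (1 - sqrt (\<mu> / Lt_y) / 4) ^ Suc m \<le> \<delta>\<^sup>2"
  proof -
    have "2 * \<kappa> * (1 - q / 4) ^ Suc m \<le> 2 * T ^ 2 * (1 / T ^ 100)"
      using \<kappa> decay_Suc q T0 by (intro mult_mono) auto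
    also have "\<dots> = 2 / T ^ 98" using T0 by (simp add: field_simps flip: power_add)
    also have "\<dots> \<le> 1 / T ^ 80" using T(1) by (rule absorb_inverse_power[of _ _ 1]) auto
    also have "\<dots> = \<delta>\<^sup>2" by (simp add: \<delta>_def power_divide flip: power_mult)
    finally show ?thesis by (simp only: \<kappa>_def q_def)
  qed
  have M: "8 / sqrt (\<mu> / Lt_y) * (1 - sqrt (\<mu> / Lt_y) / 4) ^ m \<le> \<delta>"
  proof -
    have "8 / q * (1 - q / 4) ^ m \<le> 8 * T ^ 2 * (1 / T ^ 100)"
      using \<kappa> decay q T0 by (intro mult_mono) auto
    also have "\<dots> = 8 / T ^ 98" using T0 by (simp add: field_simps flip: power_add)
    also have "\<dots> \<le> \<delta>" unfolding \<delta>_def using T(1) by (rule absorb_inverse_power[of _ _ 2]) auto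
    finally show ?thesis by (simp only: q_def)
  qed
  have err: "norm (hypergrad_estimate (regularized \<epsilon> R f) g Lt_y \<mu> lam \<theta> (Suc m) (Suc m) x - dPhi_reg \<epsilon> R x)
      \<le> 1 / T ^ 31 * (1 + norm (x - xo))" for x
  proof -
    have "norm (hypergrad_estimate (regularized \<epsilon> R f) g Lt_y \<mu> lam \<theta> (Suc m) (Suc m) x - dPhi_reg \<epsilon> R x)
      \<le> \<delta> * ((L_xy + 2 * L_y * Lt_xy / \<mu>) * norm (ys x) + Lt_xy / \<mu> * norm (grad_y f x (ys x)))"
      unfolding dPhi_reg_def by (rule estimate_error[OF lam \<theta> \<delta> N M])
    also have "\<dots> \<le> \<delta> * (T ^ 9 * (1 + norm (x - xo)))"
      by (intro mult_left_mono error_coefficient_bound[OF T(1-8) xo(1) xs(2)] \<delta>)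
    also have "\<dots> = (\<delta> * T ^ 9) * (1 + norm (x - xo))" by simp
    also have "\<delta> * T ^ 9 = 1 / T ^ 31"
      using T0 by (simp add: \<delta>_def field_simps flip: power_add)
    finally show ?thesis .
  qed
  \<comment> \<open>The two smallness conditions on \<open>\<zeta> = 1 / T ^ 31\<close>, with
    \<open>\<eta> = 1 / T ^ 50\<close>.\<close>
  have "32 * (1 / T ^ 31)\<^sup>2 \<le> (\<epsilon> / R)\<^sup>2"
  proof -
    have "32 * (1 / T ^ 31)\<^sup>2 = 32 / T ^ 62" by (simp add: power_divide flip: power_mult)
    also have "\<dots> \<le> 1 / T ^ 6" using T(1) by (rule absorb_inverse_power[of _ _ 4]) auto
    also have "\<dots> = (1 / T ^ 3)\<^sup>2" by (simp add: power_divide flip: power_mult)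
    also have "\<dots> \<le> (\<epsilon> / R)\<^sup>2" using c T0 by (intro power_mono) auto
    finally show ?thesis .
  qed
  moreover have "16 * (1 / T ^ 31)\<^sup>2 \<le> \<epsilon> / R * (1 / T ^ 50)"
  proof -
    have "16 * (1 / T ^ 31)\<^sup>2 = 16 / T ^ 62" by (simp add: power_divide flip: power_mult)
    also have "\<dots> \<le> 1 / T ^ 53" using T(1) by (rule absorb_inverse_power[of _ _ 3]) auto
    also have "\<dots> = 1 / T ^ 3 * (1 / T ^ 50)" by (simp flip: power_add)
    also have "\<dots> \<le> \<epsilon> / R * (1 / T ^ 50)" using c T0 by (intro mult_right_mono) auto
    finally show ?thesis .
  qed
  ultimately have "Phi (regularized \<epsilon> R f) g
        (accbio_z (regularized \<epsilon> R f) g L (\<epsilon> / R) Lt_y \<mu> lam \<theta> (Suc m) (Suc m) K)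
      - Phi (regularized \<epsilon> R f) g xo
      \<le> (1 - sqrt (\<epsilon> / R / L) / 4) ^ K * (L * (norm xo)\<^sup>2) + 1 / T ^ 50"
    by (rule accbio_convergence[OF c(1) L(1) xo(2) err])
  also have "(1 - sqrt (\<epsilon> / R / L) / 4) ^ K * (L * (norm xo)\<^sup>2) \<le> 1 / T ^ 100 * (T ^ 7 * T ^ 2)"
  proof (intro mult_mono)
    show "(1 - sqrt (\<epsilon> / R / L) / 4) ^ K \<le> 1 / T ^ 100"
      using K q_pos q_le_1 T0 by (intro one_minus_power_le_exp) simp_all
    show "(norm xo)\<^sup>2 \<le> T ^ 2" using xo(1) T(6) by (intro power_mono) auto
  qed (use L L_pos T0 in auto)
  also have "1 / T ^ 100 * (T ^ 7 * T ^ 2) = 1 / T ^ 91"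
    using T0 by (simp add: field_simps flip: power_add)
  also have "\<dots> \<le> 1 / T ^ 50" using T(1) by (rule absorb_inverse_power[of _ _ 0]) auto
  finally show ?thesis using xo that by simp
qed

text \<open>With \<open>R\<close> the square of \<open>B\<close> the regularizer equals
  \<open>\<epsilon> / 2\<close> at \<open>xs\<close>, which leaves the other half of
  \<open>\<epsilon>\<close> for the optimization error.\<close>

lemma suboptimality_gap:
  assumes xs: "is_arg_min (Phi f g) (\<lambda>_. True) xs" "norm xs = B"
    and T: "3 \<le> T" "1 / \<epsilon> \<le> T" and \<epsilon>: "0 < \<epsilon>"
    and xo: "\<And>u. Phi (regularized \<epsilon> (B\<^sup>2) f) g xo \<le> Phi (regularized \<epsilon> (B\<^sup>2) f) g u"
    and z: "Phi (regularized \<epsilon> (B\<^sup>2) f) g z - Phi (regularized \<epsilon> (B\<^sup>2) f) g xo \<le> 2 / T ^ 50"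
  shows "Phi f g z - Phi f g xs \<le> \<epsilon>"
proof -
  have "2 / T ^ 50 \<le> 1 / T ^ 2" using T(1) by (rule absorb_inverse_power[of _ _ 1]) auto
  also have "\<dots> \<le> \<epsilon> / 2"
  proof -
    have "2 \<le> T" "0 < T" using T(1) by simp_all
    moreover have "1 \<le> \<epsilon> * T" using T(2) \<epsilon> by (simp add: field_simps)
    ultimately have "1 * 2 \<le> (\<epsilon> * T) * T" by (intro mult_mono) auto
    then show ?thesis using \<open>0 < T\<close> by (simp add: field_simps power2_eq_square)
  qed
  finally have "2 / T ^ 50 \<le> \<epsilon> / 2" .
  moreover have "Phi f g z \<le> Phi (regularized \<epsilon> (B\<^sup>2) f) g z"
    using \<epsilon> by (simp add: Phi_regularized)
  moreover have "Phi (regularized \<epsilon> (B\<^sup>2) f) g xs = Phi f g xs + \<epsilon> / 2"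
    using B_pos xs by (simp add: Phi_regularized)
  ultimately show ?thesis
    using z xo[of xs] by linarith
qed

text \<open>The gradient at \<open>xo\<close> has norm \<open>c * norm xo\<close> with
  \<open>c * B = \<epsilon>\<close>, and \<open>minimizer_slack\<close> puts it below
  \<open>\<epsilon>\<close> by at least \<open>1 / T ^ 15\<close>. The gap \<open>2 / T ^ 50\<close>
  is small enough that passing from \<open>xo\<close> to \<open>z\<close> changes the gradient by no
  more than this margin.\<close>

lemma gradient_gap:
  assumes xs: "is_arg_min (Phi f g) (\<lambda>_. True) xs" "norm xs = B"
    and T: "3 \<le> T" "1 / \<epsilon> \<le> T" and \<epsilon>: "0 < \<epsilon>" "1 / T ^ 3 \<le> \<epsilon> / B"
    and L: "L_Phi + \<epsilon> / B \<le> L" "L \<le> T ^ 7"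
    and xo: "\<And>u. Phi (regularized \<epsilon> B f) g xo \<le> Phi (regularized \<epsilon> B f) g u"
    and z: "Phi (regularized \<epsilon> B f) g z - Phi (regularized \<epsilon> B f) g xo \<le> 2 / T ^ 50"
  shows "norm (dPhi z) \<le> \<epsilon>"
proof -
  define c where "c = \<epsilon> / B"
  have c: "0 < \<epsilon> / B" using \<epsilon> B_pos by simp
  interpret nesterov_objective "Phi (regularized \<epsilon> B f) g" "dPhi_reg \<epsilon> B" L "\<epsilon> / B" "sqrt (\<epsilon> / B / L)" xo
    by (rule nesterov_outer[OF c L(1) xo])
  have T0: "0 < T" using T(1) by simp
  have cB: "c * B = \<epsilon>" "0 < c" "c \<le> L" "1 / T ^ 3 \<le> c"
    using B_pos c mu_le \<epsilon> by (simp_all add: c_def)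
  have "c / 2 * (norm (z - xo))\<^sup>2 \<le> 2 / T ^ 50"
    using quadratic_growth[of z] z by (simp add: c_def)
  moreover have "1 / T ^ 3 / 2 * (norm (z - xo))\<^sup>2 \<le> c / 2 * (norm (z - xo))\<^sup>2"
    using cB by (intro mult_right_mono divide_right_mono) auto
  ultimately have "1 / T ^ 3 / 2 * (norm (z - xo))\<^sup>2 \<le> 2 / T ^ 50" by linarith
  then have "(norm (z - xo))\<^sup>2 \<le> 4 * T ^ 3 / T ^ 50"
    using T0 by (simp add: field_simps)
  also have "\<dots> = 4 / T ^ 47"
    using T0 by (simp add: field_simps flip: power_add)
  \<comment> \<open>Rounded to an even exponent, to allow the square root.\<close>
  also have "\<dots> \<le> 1 / T ^ 44" using T(1) by (rule absorb_inverse_power[of _ _ 2]) auto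
  also have "\<dots> = (1 / T ^ 22)\<^sup>2" by (simp add: power_divide flip: power_mult)
  finally have "norm (z - xo) \<le> 1 / T ^ 22"
    by (rule power2_le_imp_le) (use T0 in simp)
  then have "L_Phi * norm (z - xo) \<le> T ^ 7 * (1 / T ^ 22)"
    using L c T0 by (intro mult_mono) auto
  also have "\<dots> = 1 / T ^ 15"
    using T0 by (simp add: field_simps flip: power_add)
  finally have close: "norm (dPhi z - dPhi xo) \<le> 1 / T ^ 15"
    using dPhi_lipschitz[of z xo] by linarith
  have "dPhi xo = - (c *\<^sub>R xo)"
    using gradient_xo by (simp add: dPhi_reg_def c_def eq_neg_iff_add_eq_0)
  then have dxo: "norm (dPhi xo) = c * norm xo"
    using cB by simp
  have "c * (norm xo * (1 + c / (2 * L))) \<le> c * B"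
    using minimizer_slack[OF c L(1) xo xs] cB unfolding c_def[symmetric] by (intro mult_left_mono) auto
  then have "norm (dPhi xo) * (1 + c / (2 * L)) \<le> \<epsilon>"
    by (simp add: dxo cB)
  then have "norm (dPhi xo) * (2 * L + c) \<le> \<epsilon> * (2 * L)"
    using L_pos by (simp add: field_simps)
  \<comment> \<open>The margin fits because \<open>\<epsilon> * c\<close> is at least
    \<open>1 / T ^ 4\<close>, whereas \<open>2 * L + c\<close> is at most
    \<open>3 * T ^ 7\<close>.\<close>
  moreover have "(\<epsilon> - 1 / T ^ 15) * (2 * L + c) \<ge> \<epsilon> * (2 * L)"
  proof -
    have "1 / T ^ 15 * (2 * L + c) \<le> 1 / T ^ 15 * (3 * T ^ 7)"
      using cB L T0 by (intro mult_left_mono) auto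
    also have "\<dots> = 3 / T ^ 8"
      using T0 by (simp add: field_simps flip: power_add)
    also have "\<dots> \<le> 1 / T ^ 4"
      using T(1) by (rule absorb_inverse_power[of _ _ 1]) auto
    also have "\<dots> = 1 / T * (1 / T ^ 3)" by (simp flip: power_Suc)
    also have "\<dots> \<le> \<epsilon> * c"
      using T(2) \<epsilon> cB T0 by (intro mult_mono) (auto simp: field_simps)
    finally show ?thesis by (simp add: algebra_simps)
  qed
  ultimately have "norm (dPhi xo) * (2 * L + c) \<le> (\<epsilon> - 1 / T ^ 15) * (2 * L + c)"
    by linarith
  then have "norm (dPhi xo) \<le> \<epsilon> - 1 / T ^ 15"
    using L_pos cB by (simp add: mult_le_cancel_right)
  then show ?thesis
    using close norm_triangle_ineq2[of "dPhi z" "dPhi xo"] by linarith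
qed

end

section \<open>Iteration counts and the final complexity bounds\<close>

lemma parameter_choice:
  fixes \<mu> \<nu> c S \<Lambda> t \<tau> L C :: real
  assumes \<mu>: "0 < \<mu>" "\<mu> \<le> \<nu>" and c: "0 < c" "c \<le> L" and S: "1 \<le> S" and \<Lambda>: "1 \<le> \<Lambda>"
    and t: "1 \<le> t" "t \<le> S * \<Lambda>" and L: "L = 5 * S ^ 3 / \<mu>\<^sup>2" and C: "C = (10 * S) ^ 10" and \<tau>: "0 < \<tau>"
  obtains m K where "4 / sqrt (\<mu> / \<nu>) * (100 * t) \<le> real m" "4 / sqrt (c / L) * (100 * t) \<le> real K"
    "same_order (C * \<Lambda>) (real (Suc m)) (sqrt (\<nu> / \<mu>))"
    "\<tau> * (real (n_J K) + real (n_H (Suc m) K)) + real (n_G (Suc m) K)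
      \<le> (1 + \<tau>) * C * \<Lambda>\<^sup>2 * (sqrt (\<nu> / \<mu>) / (\<mu> * sqrt c))"
proof -
  define a k where "a = sqrt (\<nu> / \<mu>)" and "k = sqrt (L / c)"
  \<comment> \<open>Upper bound for \<open>t\<close>, which stands for \<open>ln T\<close>: the
    factor \<open>S\<close> will be absorbed by \<open>C\<close>, and \<open>\<Lambda>\<close>
    remains as the logarithmic factor.\<close>
  define w where "w = S * \<Lambda>"
  have w: "1 \<le> w" using mult_mono[OF S \<Lambda>] S by (simp add: w_def)
  have a: "1 \<le> a" and k: "1 \<le> k" using \<mu> c by (simp_all add: a_def k_def)
  have inv: "4 / sqrt (\<mu> / \<nu>) = 4 * a" "4 / sqrt (c / L) = 4 * k"
    by (simp_all add: a_def k_def real_sqrt_divide)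
  define m K where "m = nat \<lceil>4 * a * (100 * t)\<rceil>" and "K = nat \<lceil>4 * k * (100 * t)\<rceil>"
  have m: "4 * a * (100 * t) \<le> real m" "real m \<le> 4 * a * (100 * t) + 1"
    and K: "4 * k * (100 * t) \<le> real K" "real K \<le> 4 * k * (100 * t) + 1"
    using a k t by (simp_all add: m_def K_def of_nat_ceiling)
  have aw: "1 \<le> a * w" "a * t \<le> a * w" "1 \<le> k * w" "k * t \<le> k * w"
    using mult_mono[OF a w] mult_mono[OF k w] a k w t by (simp_all add: w_def mult_left_mono)
  \<comment> \<open>Rounding up and the additive constants are absorbed by \<open>a * w\<close> and
    \<open>k * w\<close>, both at least 1.\<close>
  have m_le: "real (Suc m) \<le> 402 * (a * w)" and m_le': "real (Suc m + 2) \<le> 404 * (a * w)" and K_le: "real K \<le> 401 * (k * w)"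
    using m(2) K(2) aw by simp_all
  have C1: "10 ^ 10 * S ^ 4 \<le> C"
    unfolding C power_mult_distrib using S by (intro mult_left_mono power_increasing) auto
  have S4: "S \<le> S ^ 4" "1 \<le> S ^ 4"
    using S power_increasing[of 1 4 S] by (simp_all add: one_le_power)
  have C2: "402 * S \<le> C" "1 \<le> C" using C1 S4 by simp_all
  have "a / (C * \<Lambda>) \<le> a"
    using mult_mono[OF C2(2) \<Lambda>] C2 a by (simp add: divide_le_eq)
  also have "a \<le> real (Suc m)"
  proof -
    have "a * 1 \<le> a * (400 * t)" using a t by (intro mult_left_mono) auto
    then show ?thesis using m(1) by simp
  qed
  finally have lower: "a / (C * \<Lambda>) \<le> real (Suc m)" .
  have upper: "real (Suc m) \<le> C * \<Lambda> * a"
  proof -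
    have "402 * S * (\<Lambda> * a) \<le> C * (\<Lambda> * a)"
      using C2 \<Lambda> a by (intro mult_right_mono) auto
    then show ?thesis using m_le by (simp add: w_def mult_ac)
  qed
  \<comment> \<open>The constant \<open>5 * S ^ 3\<close> is enlarged to the perfect square
    \<open>9 * S ^ 4\<close> before the root is taken.\<close>
  have k_le: "k \<le> 3 * S ^ 2 / (\<mu> * sqrt c)"
  proof -
    have "S ^ 3 \<le> S ^ 4" using S by (intro power_increasing) auto
    then have "5 * S ^ 3 \<le> 9 * S ^ 4" using S4 by simp
    then have "L / c \<le> 9 * S ^ 4 / \<mu>\<^sup>2 / c"
      unfolding L using c \<mu> by (intro divide_right_mono) auto
    also have "\<dots> = (3 * S ^ 2 / (\<mu> * sqrt c))\<^sup>2"
      using c by (simp add: power_divide power_mult_distrib flip: power_mult)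
    finally show ?thesis
      unfolding k_def using \<mu> c by (intro real_le_lsqrt) auto
  qed
  \<comment> \<open>With \<open>N = M = Suc m\<close>, one outer iteration costs
    \<open>\<tau> * (1 + M) + (N + 2)\<close>, and both counts are at most \<open>Suc m + 2\<close>.
    The outer and the inner count each carry one factor \<open>\<Lambda>\<close>, hence its
    square.\<close>
  have "\<tau> * (real (n_J K) + real (n_H (Suc m) K)) + real (n_G (Suc m) K)
      \<le> \<tau> * (real K * real (Suc m + 2)) + real K * real (Suc m + 2)"
    using \<tau> by (simp add: n_J_def n_H_def n_G_def algebra_simps)
  also have "\<dots> = (1 + \<tau>) * (real K * real (Suc m + 2))"
    by (simp add: algebra_simps)
  also have "\<dots> \<le> (1 + \<tau>) * ((401 * (k * w)) * (404 * (a * w)))"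
    using \<tau> K_le m_le' aw by (intro mult_left_mono mult_mono) auto
  also have "\<dots> = (1 + \<tau>) * (401 * 404 * w\<^sup>2 * a * k)"
    by (simp add: power2_eq_square)
  also have "\<dots> \<le> (1 + \<tau>) * (401 * 404 * w\<^sup>2 * a * (3 * S ^ 2 / (\<mu> * sqrt c)))"
    using \<tau> a by (intro mult_left_mono k_le) auto
  also have "\<dots> = (1 + \<tau>) * (486012 * S ^ 4 * (\<Lambda>\<^sup>2 * (a / (\<mu> * sqrt c))))"
    by (simp add: w_def power_mult_distrib eval_nat_numeral)
  also have "\<dots> \<le> (1 + \<tau>) * (C * (\<Lambda>\<^sup>2 * (a / (\<mu> * sqrt c))))"
    using \<tau> C1 S4 a \<mu> c by (intro mult_left_mono mult_right_mono) auto
  finally have cost: "\<tau> * (real (n_J K) + real (n_H (Suc m) K)) + real (n_G (Suc m) K)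
      \<le> (1 + \<tau>) * C * \<Lambda>\<^sup>2 * (a / (\<mu> * sqrt c))"
    by (simp add: mult_ac)
  show ?thesis
    using that[of m K] m(1) K(1) lower upper cost unfolding inv same_order_def a_def[symmetric] by simp
qed

text \<open>Common part of both goals: the choice of \<open>R\<close> matters here only through the
  lower bound on \<open>\<epsilon> / R\<close>, and the result is a tiny gap of the regularized
  problem at the stated cost.\<close>

lemma (in quadratic_bilevel) accbio_run:
  assumes lam: "lam = 4 / (sqrt Lt_y + sqrt \<mu>)\<^sup>2"
    and \<theta>: "\<theta> = max ((1 - sqrt (lam * \<mu>))\<^sup>2) ((1 - sqrt (lam * Lt_y))\<^sup>2)"
    and xs: "is_arg_min (Phi f g) (\<lambda>_. True) xs" "norm xs = B"
    and pos: "0 < \<epsilon>" "0 < \<tau>" and \<rho>: "\<mu> \<le> \<rho>" "\<epsilon> / R \<le> \<rho>"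
    and C: "C = hidden_const \<rho> L_x L_xy L_y Lt_xy"
    and \<Lambda>: "\<Lambda> = log_factor \<epsilon> \<mu> Lt_y B (norm (y_star g xs)) (norm (grad_y f xs (y_star g xs)))"
    and R: "0 < R" "R = B \<or> R = B\<^sup>2"
  obtains T L m K xo where "L_Phi + \<epsilon> / R \<le> L" "same_order C L (1 / \<mu>\<^sup>2)"
    "same_order (C * \<Lambda>) (real (Suc m)) (sqrt (Lt_y / \<mu>))"
    "\<tau> * (real (n_J K) + real (n_H (Suc m) K)) + real (n_G (Suc m) K)
      \<le> (1 + \<tau>) * C * \<Lambda>\<^sup>2 * (sqrt (Lt_y / \<mu>) / (\<mu> * sqrt (\<epsilon> / R)))"
    "3 \<le> T" "1 / \<epsilon> \<le> T" "1 / T ^ 3 \<le> \<epsilon> / R" "L \<le> T ^ 7"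
    "\<forall>u. Phi (regularized \<epsilon> R f) g xo \<le> Phi (regularized \<epsilon> R f) g u"
    "Phi (regularized \<epsilon> R f) g
        (accbio_z (regularized \<epsilon> R f) g L (\<epsilon> / R) Lt_y \<mu> lam \<theta> (Suc m) (Suc m) K)
      - Phi (regularized \<epsilon> R f) g xo \<le> 2 / T ^ 50"
proof -
  define S where "S = 1 + \<rho> + L_x + L_xy + L_y + Lt_xy"
  define P where "P = 3 + 1 / \<epsilon> + 1 / \<mu> + Lt_y + B + norm (ys xs) + norm (grad_y f xs (ys xs))"
  \<comment> \<open>The product separates the logarithm:
    \<open>ln T = ln S + \<Lambda> \<le> S * \<Lambda>\<close>, so the constants stay in
    \<open>S\<close> and all other quantities in \<open>\<Lambda>\<close>.\<close>
  define T where "T = S * P"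
  \<comment> \<open>Multiplied by the square of \<open>\<mu>\<close>, the Lipschitz constant is a
    sum of products of three numbers at most \<open>S\<close>, with multiplicities 1, 2, 1 and
    1.\<close>
  define L where "L = 5 * S ^ 3 / \<mu>\<^sup>2"
  have S: "1 \<le> S" "\<rho> \<le> S" "L_x \<le> S" "L_xy \<le> S" "L_y \<le> S" "Lt_xy \<le> S"
    using constants_nonneg \<rho> \<mu>_pos by (simp_all add: S_def)
  have P: "3 \<le> P" "1 / \<epsilon> \<le> P" "1 / \<mu> \<le> P" "Lt_y \<le> P" "B \<le> P"
    "norm (ys xs) \<le> P" "norm (grad_y f xs (ys xs)) \<le> P"
    using \<mu>_pos Lt_y_pos B_pos pos by (simp_all add: P_def)
  have "S \<le> T" "P \<le> T"
    using mult_mono[of 1 P S S] mult_mono[of 1 S P P] S(1) P(1) by (simp_all add: T_def mult.commute)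
  then have T: "3 \<le> T" "L_xy \<le> T" "L_y \<le> T" "Lt_xy \<le> T" "1 / \<mu> \<le> T" "B \<le> T"
    "norm (ys xs) \<le> T" "norm (grad_y f xs (ys xs)) \<le> T" "Lt_y \<le> T" "1 / \<epsilon> \<le> T"
    using S P by simp_all
  have \<Lambda>_eq: "\<Lambda> = ln P" by (simp add: \<Lambda> log_factor_def P_def y_star_g)
  \<comment> \<open>The summand 3 in \<open>log_factor\<close> ensures that the logarithm is at
    least 1.\<close>
  have "exp 1 \<le> P" using exp_le P(1) by linarith
  then have \<Lambda>1: "1 \<le> \<Lambda>" unfolding \<Lambda>_eq using P(1) by (subst ln_ge_iff) auto
  have ln_T: "1 \<le> ln T" "ln T \<le> S * \<Lambda>"
  proof -
    have "ln T = ln S + \<Lambda>" using S(1) P(1) by (simp add: T_def ln_mult \<Lambda>_eq)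
    also have "\<dots> \<le> (S - 1) + \<Lambda>" using ln_le_minus_one[of S] S(1) by simp
    also have "\<dots> \<le> S * \<Lambda>"
      using mult_nonneg_nonneg[of "S - 1" "\<Lambda> - 1"] S(1) \<Lambda>1 by (simp add: algebra_simps)
    finally show "ln T \<le> S * \<Lambda>" .
    show "1 \<le> ln T" using ln_ge_zero[OF S(1)] \<Lambda>1 \<open>ln T = ln S + \<Lambda>\<close> by simp
  qed
  have c: "0 < \<epsilon> / R" using pos R by simp
  have L_ge: "L_Phi + \<epsilon> / R \<le> L"
  proof -
    have S_mult: "x * (y * z) \<le> S ^ 3" if "0 \<le> x" "x \<le> S" "0 \<le> y" "y \<le> S" "0 \<le> z" "z \<le> S" for x y z
    proof -
      have "x * (y * z) \<le> S * (S * S)" using that by (intro mult_mono) auto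
      then show ?thesis by (simp add: power3_eq_cube)
    qed
    have "\<mu> \<le> S" "\<epsilon> / R \<le> S" using \<rho> S by simp_all
    then have "L_x * (\<mu> * \<mu>) + 2 * (L_xy * (Lt_xy * \<mu>)) + L_y * (Lt_xy * Lt_xy) + \<epsilon> / R * (\<mu> * \<mu>)
        \<le> S ^ 3 + 2 * S ^ 3 + S ^ 3 + S ^ 3"
      using S constants_nonneg \<mu>_pos c by (intro add_mono mult_left_mono S_mult) auto
    moreover have "(L_Phi + \<epsilon> / R) * \<mu>\<^sup>2
      = L_x * (\<mu> * \<mu>) + 2 * (L_xy * (Lt_xy * \<mu>)) + L_y * (Lt_xy * Lt_xy) + \<epsilon> / R * (\<mu> * \<mu>)"
      using \<mu>_pos by (simp add: L_Phi_def distrib_right power2_eq_square)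
    ultimately show ?thesis
      unfolding L_def using \<mu>_pos by (simp add: pos_le_divide_eq)
  qed
  have L_nonneg: "0 \<le> L_Phi"
    using constants_nonneg \<mu>_pos by (simp add: L_Phi_def)
  have L_le: "L \<le> T ^ 7"
  proof -
    have "L = 5 * (S ^ 3 * (1 / \<mu>)\<^sup>2)" by (simp add: L_def power_divide)
    also have "\<dots> \<le> 5 * (T ^ 3 * T\<^sup>2)"
      using \<open>S \<le> T\<close> T(1,5) S(1) \<mu>_pos by (intro mult_left_mono mult_mono power_mono) auto
    also have "\<dots> = 5 * T ^ 5" by (simp flip: power_add)
    also have "\<dots> \<le> T ^ 7" using T(1) by (rule absorb_power[of _ _ 2]) auto
    finally show ?thesis .
  qed
  have C_eq: "C = (10 * S) ^ 10" by (simp add: C hidden_const_def S_def)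
  have order_L: "same_order C L (1 / \<mu>\<^sup>2)"
  proof -
    have "5 * S ^ 3 \<le> 10 ^ 10 * S ^ 10"
      using S(1) by (intro mult_mono power_increasing) auto
    then have "5 * S ^ 3 \<le> C" by (simp add: C_eq power_mult_distrib)
    then have "L \<le> C * (1 / \<mu>\<^sup>2)"
      using \<mu>_pos by (simp add: L_def divide_right_mono)
    moreover have "1 / \<mu>\<^sup>2 / C \<le> L"
    proof -
      have "1 \<le> 10 * S" "1 \<le> S ^ 3" using S(1) by (simp_all add: one_le_power)
      then have "1 \<le> C" unfolding C_eq by (intro one_le_power)
      then have "1 / C \<le> 1" by simp
      with \<open>1 \<le> S ^ 3\<close> have "1 / C \<le> 5 * S ^ 3" by linarith
      then have "1 / C / \<mu>\<^sup>2 \<le> 5 * S ^ 3 / \<mu>\<^sup>2" by (rule divide_right_mono) simp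
      then show ?thesis by (simp add: L_def mult.commute)
    qed
    ultimately show ?thesis by (simp add: same_order_def)
  qed
  \<comment> \<open>Both admissible values of \<open>R\<close> are at most the square of
    \<open>T\<close>, and \<open>1 / \<epsilon> \<le> T\<close> supplies the third factor.\<close>
  have c_T: "1 / T ^ 3 \<le> \<epsilon> / R"
  proof -
    have "B \<le> T\<^sup>2" "B\<^sup>2 \<le> T\<^sup>2"
      using T(1,6) B_pos power_increasing[of 1 2 T] by (auto intro: power_mono order_trans)
    then have "R \<le> T\<^sup>2" using R by auto
    then have "R * (1 / \<epsilon>) \<le> T\<^sup>2 * T"
      using T pos R by (intro mult_mono) auto
    then show ?thesis
      using T(1) pos R by (simp add: field_simps power2_eq_square power3_eq_cube)
  qed
  have "\<epsilon> / R \<le> L" using L_ge L_nonneg by linarith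
  then obtain m K where mK: "4 / sqrt (\<mu> / Lt_y) * (100 * ln T) \<le> real m" "4 / sqrt (\<epsilon> / R / L) * (100 * ln T) \<le> real K"
    "same_order (C * \<Lambda>) (real (Suc m)) (sqrt (Lt_y / \<mu>))"
    "\<tau> * (real (n_J K) + real (n_H (Suc m) K)) + real (n_G (Suc m) K)
      \<le> (1 + \<tau>) * C * \<Lambda>\<^sup>2 * (sqrt (Lt_y / \<mu>) / (\<mu> * sqrt (\<epsilon> / R)))"
    using parameter_choice[OF \<mu>_pos \<mu>_le c _ S(1) \<Lambda>1 ln_T L_def C_eq pos(2)] by blast
  obtain xo where xo: "norm xo \<le> B" "\<forall>u. Phi (regularized \<epsilon> R f) g xo \<le> Phi (regularized \<epsilon> R f) g u"
    "Phi (regularized \<epsilon> R f) g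
        (accbio_z (regularized \<epsilon> R f) g L (\<epsilon> / R) Lt_y \<mu> lam \<theta> (Suc m) (Suc m) K)
      - Phi (regularized \<epsilon> R f) g xo \<le> 2 / T ^ 50"
    by (rule accbio_accuracy[OF lam \<theta> xs T(1-9) c c_T L_ge L_le mK(1,2)])
  show ?thesis
    by (rule that[OF L_ge order_L mK(3,4) T(1,10) c_T L_le xo(2,3)])
qed

theorem corollary2:
  fixes f g :: "real^'p \<Rightarrow> real^'q \<Rightarrow> real"
    and H :: "real^'q^'q" and J :: "real^'q^'p" and b :: "real^'q" and h :: "real^'p \<Rightarrow> real"
    and xs :: "real^'p"
    and L_x L_xy L_y Lt_xy Lt_y \<mu>_y B \<epsilon> \<tau> \<rho> lam \<theta> C \<Lambda> :: real
  assumes cls: "(f, g) \<in> F_csc L_x L_xy L_y Lt_xy Lt_y \<mu>_y B"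
    and xs: "is_arg_min (Phi f g) (\<lambda>_. True) xs" "norm xs = B"
    and quadratic: "\<And>x y. g x y = 1 / 2 * (y \<bullet> (H *v y)) + x \<bullet> (J *v y) + b \<bullet> y + h x"
    and H: "transpose H = H" "H \<preceq> mat Lt_y"
    and J: "onorm ((*v) J) \<le> Lt_xy"
    and pos: "\<epsilon> > 0" "\<tau> > 0"
    and \<rho>: "\<mu>_y \<le> \<rho>"
    and lam: "lam = 4 / (sqrt Lt_y + sqrt \<mu>_y)\<^sup>2"
    and \<theta>: "\<theta> = max ((1 - sqrt (lam * \<mu>_y))\<^sup>2) ((1 - sqrt (lam * Lt_y))\<^sup>2)"
    and C: "C = hidden_const \<rho> L_x L_xy L_y Lt_xy"
    and \<Lambda>: "\<Lambda> = log_factor \<epsilon> \<mu>_y Lt_y B (norm (y_star g xs)) (norm (grad_y f xs (y_star g xs)))"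
  shows
    "(\<forall>R. R = B\<^sup>2 \<and> \<epsilon> / R \<le> \<rho> \<longrightarrow>
      (\<exists>L N M. smooth_fun L (Phi (regularized \<epsilon> R f) g)
        \<and> same_order C L (1 / \<mu>_y\<^sup>2)
        \<and> same_order (C * \<Lambda>) (real N) (sqrt (Lt_y / \<mu>_y))
        \<and> same_order (C * \<Lambda>) (real M) (sqrt (Lt_y / \<mu>_y))
        \<and> C_sub \<tau> N M (Phi f g) xs
             (accbio_z (regularized \<epsilon> R f) g L (\<epsilon> / R) Lt_y \<mu>_y lam \<theta> N M) \<epsilon>
           \<le> ereal ((1 + \<tau>) * C * \<Lambda>\<^sup>2 * (B * sqrt (Lt_y / (\<epsilon> * \<mu>_y ^ 3))))))
     \<and>
     (\<forall>R. R = B \<and> \<epsilon> / R \<le> \<rho> \<longrightarrow>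
      (\<exists>L N M. smooth_fun L (Phi (regularized \<epsilon> R f) g)
        \<and> same_order C L (1 / \<mu>_y\<^sup>2)
        \<and> same_order (C * \<Lambda>) (real N) (sqrt (Lt_y / \<mu>_y))
        \<and> same_order (C * \<Lambda>) (real M) (sqrt (Lt_y / \<mu>_y))
        \<and> C_norm \<tau> N M (Phi f g)
             (accbio_z (regularized \<epsilon> R f) g L (\<epsilon> / R) Lt_y \<mu>_y lam \<theta> N M) \<epsilon>
           \<le> ereal ((1 + \<tau>) * C * \<Lambda>\<^sup>2 * sqrt (B * Lt_y / (\<epsilon> * \<mu>_y ^ 3)))))"
proof -
  interpret quadratic_bilevel f g H J b h L_x L_xy L_y Lt_xy Lt_y \<mu>_y B
    using cls quadratic H J by unfold_locales
  \<comment> \<open>The complexity is an infimum over run lengths, so one successful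
    \<open>K\<close> bounds it.\<close>
  have complexity_le: "complexity \<tau> N M goal \<le> ereal c"
    if "goal K" "\<tau> * (real (n_J K) + real (n_H M K)) + real (n_G N K) \<le> c" for goal N M K c
    unfolding complexity_def by (rule INF_lower2[of K]) (use that in auto)
  \<comment> \<open>One formula for both goals: \<open>B\<close> leaves the root when
    \<open>R\<close> is its square and stays inside when \<open>R = B\<close>.\<close>
  have rate: "sqrt (Lt_y / \<mu>_y) / (\<mu>_y * sqrt (\<epsilon> / R)) = sqrt (R * Lt_y / (\<epsilon> * \<mu>_y ^ 3))" for R
  proof -
    have "sqrt (\<mu>_y ^ 3) = \<mu>_y * sqrt \<mu>_y"
      using \<mu>_pos by (simp add: power3_eq_cube real_sqrt_mult)
    then show ?thesis
      by (simp add: real_sqrt_divide real_sqrt_mult mult_ac)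
  qed
  show ?thesis
  proof (intro conjI allI impI)
    fix R assume R: "R = B\<^sup>2 \<and> \<epsilon> / R \<le> \<rho>"
    have R': "R = B\<^sup>2" using R by (rule conjunct1)
    have \<rho>': "\<epsilon> / R \<le> \<rho>" using R by (rule conjunct2)
    have R_pos: "0 < R" using B_pos R' by simp
    obtain T L m K xo where run: "L_Phi + \<epsilon> / R \<le> L" "same_order C L (1 / \<mu>_y\<^sup>2)"
      "same_order (C * \<Lambda>) (real (Suc m)) (sqrt (Lt_y / \<mu>_y))"
      "\<tau> * (real (n_J K) + real (n_H (Suc m) K)) + real (n_G (Suc m) K)
        \<le> (1 + \<tau>) * C * \<Lambda>\<^sup>2 * (sqrt (Lt_y / \<mu>_y) / (\<mu>_y * sqrt (\<epsilon> / R)))"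
      "3 \<le> T" "1 / \<epsilon> \<le> T" "1 / T ^ 3 \<le> \<epsilon> / R" "L \<le> T ^ 7"
      "\<forall>u. Phi (regularized \<epsilon> R f) g xo \<le> Phi (regularized \<epsilon> R f) g u"
      "Phi (regularized \<epsilon> R f) g
          (accbio_z (regularized \<epsilon> R f) g L (\<epsilon> / R) Lt_y \<mu>_y lam \<theta> (Suc m) (Suc m) K)
        - Phi (regularized \<epsilon> R f) g xo \<le> 2 / T ^ 50"
      by (rule accbio_run[OF lam \<theta> xs pos \<rho> \<rho>' C \<Lambda> R_pos disjI2[OF R']])
    have "sqrt (R * Lt_y / (\<epsilon> * \<mu>_y ^ 3)) = B * sqrt (Lt_y / (\<epsilon> * \<mu>_y ^ 3))"
      using B_pos unfolding R' times_divide_eq_right[symmetric] real_sqrt_mult by simp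
    note cost = run(4)[unfolded rate this]
    have "C_sub \<tau> (Suc m) (Suc m) (Phi f g) xs
        (accbio_z (regularized \<epsilon> R f) g L (\<epsilon> / R) Lt_y \<mu>_y lam \<theta> (Suc m) (Suc m)) \<epsilon>
      \<le> ereal ((1 + \<tau>) * C * \<Lambda>\<^sup>2 * (B * sqrt (Lt_y / (\<epsilon> * \<mu>_y ^ 3))))"
      unfolding C_sub_def
      by (rule complexity_le[OF _ cost])
        (rule suboptimality_gap[OF xs run(5,6) pos(1) run(9)[rule_format, unfolded R'] run(10)[unfolded R'], folded R'])
    moreover have "smooth_fun L (Phi (regularized \<epsilon> R f) g)"
      using run(1) R_pos pos(1) by (intro smooth_Phi_reg) auto
    ultimately show "\<exists>L N M. smooth_fun L (Phi (regularized \<epsilon> R f) g)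
        \<and> same_order C L (1 / \<mu>_y\<^sup>2)
        \<and> same_order (C * \<Lambda>) (real N) (sqrt (Lt_y / \<mu>_y))
        \<and> same_order (C * \<Lambda>) (real M) (sqrt (Lt_y / \<mu>_y))
        \<and> C_sub \<tau> N M (Phi f g) xs
             (accbio_z (regularized \<epsilon> R f) g L (\<epsilon> / R) Lt_y \<mu>_y lam \<theta> N M) \<epsilon>
           \<le> ereal ((1 + \<tau>) * C * \<Lambda>\<^sup>2 * (B * sqrt (Lt_y / (\<epsilon> * \<mu>_y ^ 3))))"
      using run(2,3) by blast
  next
    fix R assume R: "R = B \<and> \<epsilon> / R \<le> \<rho>"
    have R': "R = B" using R by (rule conjunct1)
    have \<rho>': "\<epsilon> / R \<le> \<rho>" using R by (rule conjunct2)
    have R_pos: "0 < R" using B_pos R' by simp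
    obtain T L m K xo where run: "L_Phi + \<epsilon> / R \<le> L" "same_order C L (1 / \<mu>_y\<^sup>2)"
      "same_order (C * \<Lambda>) (real (Suc m)) (sqrt (Lt_y / \<mu>_y))"
      "\<tau> * (real (n_J K) + real (n_H (Suc m) K)) + real (n_G (Suc m) K)
        \<le> (1 + \<tau>) * C * \<Lambda>\<^sup>2 * (sqrt (Lt_y / \<mu>_y) / (\<mu>_y * sqrt (\<epsilon> / R)))"
      "3 \<le> T" "1 / \<epsilon> \<le> T" "1 / T ^ 3 \<le> \<epsilon> / R" "L \<le> T ^ 7"
      "\<forall>u. Phi (regularized \<epsilon> R f) g xo \<le> Phi (regularized \<epsilon> R f) g u"
      "Phi (regularized \<epsilon> R f) g
          (accbio_z (regularized \<epsilon> R f) g L (\<epsilon> / R) Lt_y \<mu>_y lam \<theta> (Suc m) (Suc m) K)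
        - Phi (regularized \<epsilon> R f) g xo \<le> 2 / T ^ 50"
      by (rule accbio_run[OF lam \<theta> xs pos \<rho> \<rho>' C \<Lambda> R_pos disjI1[OF R']])
    note cost = run(4)[unfolded rate]
    have "C_norm \<tau> (Suc m) (Suc m) (Phi f g)
        (accbio_z (regularized \<epsilon> R f) g L (\<epsilon> / R) Lt_y \<mu>_y lam \<theta> (Suc m) (Suc m)) \<epsilon>
      \<le> ereal ((1 + \<tau>) * C * \<Lambda>\<^sup>2 * sqrt (R * Lt_y / (\<epsilon> * \<mu>_y ^ 3)))"
      unfolding C_norm_def grad_Phi
      by (rule complexity_le[OF _ cost])
        (rule gradient_gap[OF xs run(5,6) pos(1) run(7,1,8)[unfolded R'] run(9)[rule_format, unfolded R'] run(10)[unfolded R'], folded R'])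
    moreover have "smooth_fun L (Phi (regularized \<epsilon> R f) g)"
      using run(1) R_pos pos(1) by (intro smooth_Phi_reg) auto
    ultimately show "\<exists>L N M. smooth_fun L (Phi (regularized \<epsilon> R f) g)
        \<and> same_order C L (1 / \<mu>_y\<^sup>2)
        \<and> same_order (C * \<Lambda>) (real N) (sqrt (Lt_y / \<mu>_y))
        \<and> same_order (C * \<Lambda>) (real M) (sqrt (Lt_y / \<mu>_y))
        \<and> C_norm \<tau> N M (Phi f g)
             (accbio_z (regularized \<epsilon> R f) g L (\<epsilon> / R) Lt_y \<mu>_y lam \<theta> N M) \<epsilon>
           \<le> ereal ((1 + \<tau>) * C * \<Lambda>\<^sup>2 * sqrt (B * Lt_y / (\<epsilon> * \<mu>_y ^ 3)))"
      using run(2,3) unfolding R' by blast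
  qed
qed

end
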